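(* Let $\Gamma$ be a row-finite digraph and $\mathbb F$ a field. Then the Leavitt path algebra $L(\Gamma)$ is a flat left $\mathbb F\Gamma$-module.
   Context: A digraph $\Gamma=(V,E,s,t)$ has vertex set $V$, arrow set $E$ (possibly infinite) and source and target maps $s,t$; it is row-finite if $s^{-1}(v)$ is finite for all $v\in V$. The path algebra $\mathbb F\Gamma$ has the paths of $\Gamma$ (including vertices, as paths of length $0$) as basis with concatenation product ($0$ if not composable). $L(\Gamma)$ is the (not necessarily unital) $\mathbb F$-algebra generated by $V\sqcup E\sqcup E^*$, $E^*=\{e^*:e\in E\}$, $s(e^* )=t(e)$, $t(e^* )=s(e)$, subject to $vw=\delta_{v,w}v$ ($v,w\in V$); $s(e)e=e=e\,t(e)$ ($e\in E\sqcup E^*$); $e^*f=\delta_{e,f}\,t(e)$ ($e,f\in E$); $v=\sum_{s(e)=v}ee^*$ for every $v$ with $s^{-1}(v)\ne\emptyset$. $L(\Gamma)$ is a left $\mathbb F\Gamma$-module via the natural homomorphism $\mathbb F\Gamma\to L(\Gamma)$. Flatness means that $\underline{\ \ }\otimes_{\mathbb F\Gamma}L(\Gamma)$ is exact on the category of unital right $\mathbb F\Gamma$-modules, i.e. right modules $M$ with $M\,\mathbb F\Gamma=M$. *)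

theory Defs
  imports
    "HOL-Algebra.Algebra"
    "HOL-Library.Poly_Mapping"
    "Graph_Theory.Digraph"
    "Graph_Theory.Arc_Walk"
begin

section \<open>Modules over rings without unit\<close>

text \<open>
  Rings are not assumed to be unital. They are carried by the record type \<^typ>\<open>'a ring\<close>,
  whose field \<^const>\<open>one\<close> is ignored, just as \<^locale>\<open>abelian_group\<close>
  ignores both \<^const>\<open>one\<close> and \<^const>\<open>monoid.mult\<close>.
\<close>

locale nonunital_ring = abelian_group R for R (structure) +
  assumes mult_closed: "\<lbrakk>a \<in> carrier R; b \<in> carrier R\<rbrakk> \<Longrightarrow> a \<otimes> b \<in> carrier R"
    and mult_assoc: "\<lbrakk>a \<in> carrier R; b \<in> carrier R; c \<in> carrier R\<rbrakk>
      \<Longrightarrow> (a \<otimes> b) \<otimes> c = a \<otimes> (b \<otimes> c)"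
    and distrib_right: "\<lbrakk>a \<in> carrier R; b \<in> carrier R; c \<in> carrier R\<rbrakk>
      \<Longrightarrow> (a \<oplus> b) \<otimes> c = a \<otimes> c \<oplus> b \<otimes> c"
    and distrib_left: "\<lbrakk>a \<in> carrier R; b \<in> carrier R; c \<in> carrier R\<rbrakk>
      \<Longrightarrow> a \<otimes> (b \<oplus> c) = a \<otimes> b \<oplus> a \<otimes> c"

locale left_module = R?: nonunital_ring R + L?: abelian_group L
  for R :: "('a, 'r) ring_scheme" (structure) and L :: "('a, 'l, 's) module_scheme" (structure) +
  assumes smult_closed: "\<lbrakk>a \<in> carrier R; x \<in> carrier L\<rbrakk> \<Longrightarrow> a \<odot>\<^bsub>L\<^esub> x \<in> carrier L"
    and smult_add_left: "\<lbrakk>a \<in> carrier R; b \<in> carrier R; x \<in> carrier L\<rbrakk>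
      \<Longrightarrow> (a \<oplus>\<^bsub>R\<^esub> b) \<odot>\<^bsub>L\<^esub> x = a \<odot>\<^bsub>L\<^esub> x \<oplus>\<^bsub>L\<^esub> b \<odot>\<^bsub>L\<^esub> x"
    and smult_add_right: "\<lbrakk>a \<in> carrier R; x \<in> carrier L; y \<in> carrier L\<rbrakk>
      \<Longrightarrow> a \<odot>\<^bsub>L\<^esub> (x \<oplus>\<^bsub>L\<^esub> y) = a \<odot>\<^bsub>L\<^esub> x \<oplus>\<^bsub>L\<^esub> a \<odot>\<^bsub>L\<^esub> y"
    and smult_mult: "\<lbrakk>a \<in> carrier R; b \<in> carrier R; x \<in> carrier L\<rbrakk>
      \<Longrightarrow> (a \<otimes>\<^bsub>R\<^esub> b) \<odot>\<^bsub>L\<^esub> x = a \<odot>\<^bsub>L\<^esub> (b \<odot>\<^bsub>L\<^esub> x)"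

record ('a, 'm) right_mod = "'m ring" +
  rsmult :: "'m \<Rightarrow> 'a \<Rightarrow> 'm" (infixl \<open>\<cdot>\<index>\<close> 70)

locale right_module = R?: nonunital_ring R + M?: abelian_group M
  for R :: "('a, 'r) ring_scheme" (structure)
    and M :: "('a, 'm, 's) right_mod_scheme" (structure) +
  assumes rsmult_closed: "\<lbrakk>m \<in> carrier M; a \<in> carrier R\<rbrakk> \<Longrightarrow> m \<cdot>\<^bsub>M\<^esub> a \<in> carrier M"
    and rsmult_add_left: "\<lbrakk>m \<in> carrier M; n \<in> carrier M; a \<in> carrier R\<rbrakk>
      \<Longrightarrow> (m \<oplus>\<^bsub>M\<^esub> n) \<cdot>\<^bsub>M\<^esub> a = m \<cdot>\<^bsub>M\<^esub> a \<oplus>\<^bsub>M\<^esub> n \<cdot>\<^bsub>M\<^esub> a"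
    and rsmult_add_right: "\<lbrakk>m \<in> carrier M; a \<in> carrier R; b \<in> carrier R\<rbrakk>
      \<Longrightarrow> m \<cdot>\<^bsub>M\<^esub> (a \<oplus>\<^bsub>R\<^esub> b) = m \<cdot>\<^bsub>M\<^esub> a \<oplus>\<^bsub>M\<^esub> m \<cdot>\<^bsub>M\<^esub> b"
    and rsmult_mult: "\<lbrakk>m \<in> carrier M; a \<in> carrier R; b \<in> carrier R\<rbrakk>
      \<Longrightarrow> m \<cdot>\<^bsub>M\<^esub> (a \<otimes>\<^bsub>R\<^esub> b) = (m \<cdot>\<^bsub>M\<^esub> a) \<cdot>\<^bsub>M\<^esub> b"

text \<open>Here \<open>M R\<close> is the set of finite sums of products, whence \<^const>\<open>generate\<close>.\<close>

locale unital_right_module = right_module +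
  assumes unital: "generate (add_monoid M) {m \<cdot>\<^bsub>M\<^esub> a | m a. m \<in> carrier M \<and> a \<in> carrier R}
    = carrier M"

definition right_module_hom ::
    "('a, 'r) ring_scheme \<Rightarrow> ('a, 'm) right_mod \<Rightarrow> ('a, 'n) right_mod \<Rightarrow> ('m \<Rightarrow> 'n) set"
  where "right_module_hom R M N =
    {f \<in> hom (add_monoid M) (add_monoid N).
      \<forall>m\<in>carrier M. \<forall>a\<in>carrier R. f (m \<cdot>\<^bsub>M\<^esub> a) = f m \<cdot>\<^bsub>N\<^esub> a}"


section \<open>Tensor products and flatness\<close>

definition tensor_relators ::
    "('a, 'r) ring_scheme \<Rightarrow> ('a, 'm) right_mod \<Rightarrow> ('a, 'l) module \<Rightarrow> ('m \<times> 'l \<Rightarrow>\<^sub>0 int) set"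
  where "tensor_relators R M L =
    {frag_of (m \<oplus>\<^bsub>M\<^esub> n, x) - (frag_of (m, x) + frag_of (n, x))
      | m n x. m \<in> carrier M \<and> n \<in> carrier M \<and> x \<in> carrier L} \<union>
    {frag_of (m, x \<oplus>\<^bsub>L\<^esub> y) - (frag_of (m, x) + frag_of (m, y))
      | m x y. m \<in> carrier M \<and> x \<in> carrier L \<and> y \<in> carrier L} \<union>
    {frag_of (m \<cdot>\<^bsub>M\<^esub> a, x) - frag_of (m, a \<odot>\<^bsub>L\<^esub> x)
      | m a x. m \<in> carrier M \<and> a \<in> carrier R \<and> x \<in> carrier L}"

definition tensor_kernel ::
    "('a, 'r) ring_scheme \<Rightarrow> ('a, 'm) right_mod \<Rightarrow> ('a, 'l) module \<Rightarrow> ('m \<times> 'l \<Rightarrow>\<^sub>0 int) set"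
  where "tensor_kernel R M L =
    generate (free_Abelian_group (carrier M \<times> carrier L)) (tensor_relators R M L)"

definition tensor_product ::
    "('a, 'r) ring_scheme \<Rightarrow> ('a, 'm) right_mod \<Rightarrow> ('a, 'l) module
      \<Rightarrow> ('m \<times> 'l \<Rightarrow>\<^sub>0 int) set monoid"
  where "tensor_product R M L =
    free_Abelian_group (carrier M \<times> carrier L) Mod tensor_kernel R M L"

text \<open>The map \<open>f \<otimes> id\<close> from \<open>M \<otimes> L\<close> to \<open>N \<otimes> L\<close>, on cosets.\<close>

definition tensor_map ::
    "('a, 'r) ring_scheme \<Rightarrow> ('a, 'n) right_mod \<Rightarrow> ('a, 'l) module \<Rightarrow> ('m \<Rightarrow> 'n)
      \<Rightarrow> ('m \<times> 'l \<Rightarrow>\<^sub>0 int) set \<Rightarrow> ('n \<times> 'l \<Rightarrow>\<^sub>0 int) set"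
  where "tensor_map R N L f C =
    (\<Union>c\<in>C. tensor_kernel R N L #>\<^bsub>free_Abelian_group (carrier N \<times> carrier L)\<^esub>
      frag_extend (\<lambda>(m, x). frag_of (f m, x)) c)"

text \<open>
  Exactness of \<open>0 \<rightarrow> A \<rightarrow> B \<rightarrow> C \<rightarrow> 0\<close>.
  The library's \<^const>\<open>short_exact_sequence\<close> forces the three groups to have elements
  of the same type.
\<close>

definition short_exact ::
    "('a, 'r) monoid_scheme \<Rightarrow> ('b, 's) monoid_scheme \<Rightarrow> ('c, 't) monoid_scheme
      \<Rightarrow> ('a \<Rightarrow> 'b) \<Rightarrow> ('b \<Rightarrow> 'c) \<Rightarrow> bool"
  where "short_exact A B C f g \<longleftrightarrow>
    group A \<and> group B \<and> group C \<and> f \<in> mon A B \<and> g \<in> epi B C \<and> kernel B C g = f ` carrier A"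

text \<open>
  Flatness: tensoring with \<open>L\<close> is an exact functor on unital right modules.
  HOL cannot quantify over types inside a formula, so the element types of the three modules
  of a short exact sequence are parameters; a theorem in which they are type variables
  asserts flatness for modules over all types.
\<close>

definition flat_left_module ::
    "('a, 'r) ring_scheme \<Rightarrow> ('a, 'l) module
      \<Rightarrow> 'm1 itself \<Rightarrow> 'm2 itself \<Rightarrow> 'm3 itself \<Rightarrow> bool"
  where "flat_left_module R L (_ :: 'm1 itself) (_ :: 'm2 itself) (_ :: 'm3 itself) \<longleftrightarrow>
    left_module R L \<and>
    (\<forall>(M1 :: ('a, 'm1) right_mod) (M2 :: ('a, 'm2) right_mod) (M3 :: ('a, 'm3) right_mod) f g.
      unital_right_module R M1 \<and> unital_right_module R M2 \<and> unital_right_module R M3 \<and>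
      f \<in> right_module_hom R M1 M2 \<and> g \<in> right_module_hom R M2 M3 \<and>
      short_exact (add_monoid M1) (add_monoid M2) (add_monoid M3) f g
      \<longrightarrow> short_exact (tensor_product R M1 L) (tensor_product R M2 L) (tensor_product R M3 L)
            (tensor_map R M2 L f) (tensor_map R M3 L g))"


section \<open>Algebras with a multiplicative basis\<close>

text \<open>
  The vector space with basis \<open>P\<close>, multiplied by the bilinear extension of a partial product
  on \<open>P\<close>; undefined products are \<open>0\<close>. The field \<^const>\<open>module.smult\<close> is multiplication by scalars.
\<close>

definition basis_algebra ::
    "'p set \<Rightarrow> ('p \<Rightarrow> 'p \<Rightarrow> 'p option) \<Rightarrow> ('k::field, 'p \<Rightarrow>\<^sub>0 'k) module"
  where "basis_algebra P prd =
    \<lparr>carrier = {a. Poly_Mapping.keys a \<subseteq> P},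
     monoid.mult = (\<lambda>a b. \<Sum>x\<in>Poly_Mapping.keys a. \<Sum>y\<in>Poly_Mapping.keys b.
       (case prd x y of
          None \<Rightarrow> 0
        | Some z \<Rightarrow> Poly_Mapping.single z (Poly_Mapping.lookup a x * Poly_Mapping.lookup b y))),
     one = undefined,
     ring.zero = 0,
     ring.add = (+),
     module.smult = (\<lambda>c. Poly_Mapping.map ((*) c))\<rparr>"

text \<open>The free non-unital associative algebra: its basis consists of the nonempty words.\<close>

definition free_algebra :: "'g set \<Rightarrow> ('k::field, 'g list \<Rightarrow>\<^sub>0 'k) module"
  where "free_algebra S = basis_algebra (lists S - {[]}) (\<lambda>v w. Some (v @ w))"

inductive_set generated_ideal :: "('k, 'a) module \<Rightarrow> 'a set \<Rightarrow> 'a set"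
  for A (structure) and S where
  gen: "a \<in> S \<Longrightarrow> a \<in> generated_ideal A S"
| zero: "\<zero> \<in> generated_ideal A S"
| add: "\<lbrakk>a \<in> generated_ideal A S; b \<in> generated_ideal A S\<rbrakk> \<Longrightarrow> a \<oplus> b \<in> generated_ideal A S"
| smult: "a \<in> generated_ideal A S \<Longrightarrow> c \<odot> a \<in> generated_ideal A S"
| lmult: "\<lbrakk>r \<in> carrier A; a \<in> generated_ideal A S\<rbrakk> \<Longrightarrow> r \<otimes> a \<in> generated_ideal A S"
| rmult: "\<lbrakk>a \<in> generated_ideal A S; r \<in> carrier A\<rbrakk> \<Longrightarrow> a \<otimes> r \<in> generated_ideal A S"

definition quotient_algebra :: "('k, 'a) module \<Rightarrow> 'a set \<Rightarrow> ('k, 'a set) module"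
  where "quotient_algebra A I =
    ring.extend (A Quot I) (module.fields (\<lambda>c C. \<Union>x\<in>C. I +>\<^bsub>A\<^esub> (c \<odot>\<^bsub>A\<^esub> x)))"


section \<open>Path algebras and Leavitt path algebras\<close>

definition row_finite :: "('v, 'e) pre_digraph \<Rightarrow> bool"
  where "row_finite \<Gamma> \<longleftrightarrow> (\<forall>v\<in>verts \<Gamma>. finite (out_arcs \<Gamma> v))"

text \<open>
  A path is encoded as its source together with its list of arrows; the vertex \<open>v\<close> is the
  path \<open>(v, [])\<close>.
\<close>

definition paths :: "('v, 'e) pre_digraph \<Rightarrow> ('v \<times> 'e list) set"
  where "paths \<Gamma> = {(u, p). \<exists>v. pre_digraph.awalk \<Gamma> u p v}"

definition path_prod ::
    "('v, 'e) pre_digraph \<Rightarrow> 'v \<times> 'e list \<Rightarrow> 'v \<times> 'e list \<Rightarrow> ('v \<times> 'e list) option"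
  where "path_prod \<Gamma> x y =
    (if last (pre_digraph.awalk_verts \<Gamma> (fst x) (snd x)) = fst y
     then Some (fst x, snd x @ snd y) else None)"

definition path_algebra ::
    "('v, 'e) pre_digraph \<Rightarrow> ('k::field, 'v \<times> 'e list \<Rightarrow>\<^sub>0 'k) module"
  where "path_algebra \<Gamma> = basis_algebra (paths \<Gamma>) (path_prod \<Gamma>)"

datatype ('v, 'e) leavitt_gen = Vertex 'v | Arrow 'e | Ghost 'e

definition leavitt_gens :: "('v, 'e) pre_digraph \<Rightarrow> ('v, 'e) leavitt_gen set"
  where "leavitt_gens \<Gamma> = Vertex ` verts \<Gamma> \<union> Arrow ` arcs \<Gamma> \<union> Ghost ` arcs \<Gamma>"

primrec gen_source :: "('v, 'e) pre_digraph \<Rightarrow> ('v, 'e) leavitt_gen \<Rightarrow> 'v" where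
  "gen_source \<Gamma> (Vertex v) = v"
| "gen_source \<Gamma> (Arrow e) = tail \<Gamma> e"
| "gen_source \<Gamma> (Ghost e) = head \<Gamma> e"

primrec gen_target :: "('v, 'e) pre_digraph \<Rightarrow> ('v, 'e) leavitt_gen \<Rightarrow> 'v" where
  "gen_target \<Gamma> (Vertex v) = v"
| "gen_target \<Gamma> (Arrow e) = head \<Gamma> e"
| "gen_target \<Gamma> (Ghost e) = tail \<Gamma> e"

abbreviation word :: "'g list \<Rightarrow> 'g list \<Rightarrow>\<^sub>0 'k::field"
  where "word w \<equiv> Poly_Mapping.single w 1"

text \<open>
  The last family of relators is the intended one only for row-finite digraphs, since sums over
  infinite sets are \<open>0\<close>.
\<close>

definition leavitt_relators ::
    "('v, 'e) pre_digraph \<Rightarrow> (('v, 'e) leavitt_gen list \<Rightarrow>\<^sub>0 'k::field) set"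
  where "leavitt_relators \<Gamma> =
    {word [Vertex v, Vertex w] - (if v = w then word [Vertex v] else 0)
      | v w. v \<in> verts \<Gamma> \<and> w \<in> verts \<Gamma>} \<union>
    {word [Vertex (gen_source \<Gamma> x), x] - word [x]
      | x. x \<in> Arrow ` arcs \<Gamma> \<union> Ghost ` arcs \<Gamma>} \<union>
    {word [x, Vertex (gen_target \<Gamma> x)] - word [x]
      | x. x \<in> Arrow ` arcs \<Gamma> \<union> Ghost ` arcs \<Gamma>} \<union>
    {word [Ghost e, Arrow f] - (if e = f then word [Vertex (head \<Gamma> e)] else 0)
      | e f. e \<in> arcs \<Gamma> \<and> f \<in> arcs \<Gamma>} \<union>
    {word [Vertex v] - (\<Sum>e\<in>out_arcs \<Gamma> v. word [Arrow e, Ghost e])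
      | v. v \<in> verts \<Gamma> \<and> out_arcs \<Gamma> v \<noteq> {}}"

definition leavitt_ideal ::
    "('v, 'e) pre_digraph \<Rightarrow> (('v, 'e) leavitt_gen list \<Rightarrow>\<^sub>0 'k::field) set"
  where "leavitt_ideal \<Gamma> = generated_ideal (free_algebra (leavitt_gens \<Gamma>)) (leavitt_relators \<Gamma>)"

definition leavitt_path_algebra ::
    "('v, 'e) pre_digraph \<Rightarrow> ('k::field, (('v, 'e) leavitt_gen list \<Rightarrow>\<^sub>0 'k) set) module"
  where "leavitt_path_algebra \<Gamma> =
    quotient_algebra (free_algebra (leavitt_gens \<Gamma>)) (leavitt_ideal \<Gamma>)"

primrec path_word :: "'v \<times> 'e list \<Rightarrow> ('v, 'e) leavitt_gen list"
  where "path_word (u, p) = (if p = [] then [Vertex u] else map Arrow p)"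

text \<open>
  The natural homomorphism from the path algebra to the Leavitt path algebra: the linear map
  sending each vertex and each arrow to its class.
\<close>

definition natural_hom ::
    "('v, 'e) pre_digraph \<Rightarrow> ('v \<times> 'e list \<Rightarrow>\<^sub>0 'k::field)
      \<Rightarrow> (('v, 'e) leavitt_gen list \<Rightarrow>\<^sub>0 'k) set"
  where "natural_hom \<Gamma> a =
    leavitt_ideal \<Gamma> +>\<^bsub>free_algebra (leavitt_gens \<Gamma>)\<^esub>
      (\<Sum>x\<in>Poly_Mapping.keys a. Poly_Mapping.single (path_word x) (Poly_Mapping.lookup a x))"

text \<open>
  The Leavitt path algebra as a left module over the path algebra: here \<^const>\<open>module.smult\<close> is the
  action of the path algebra and no longer multiplication by scalars.
\<close>

definition leavitt_left_module ::
    "('v, 'e) pre_digraph \<Rightarrow>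
      ('v \<times> 'e list \<Rightarrow>\<^sub>0 'k::field, (('v, 'e) leavitt_gen list \<Rightarrow>\<^sub>0 'k) set) module"
  where "leavitt_left_module \<Gamma> =
    ring.extend (ring.truncate (leavitt_path_algebra \<Gamma> :: ('k, _) module))
      (module.fields (\<lambda>a x. natural_hom \<Gamma> a \<otimes>\<^bsub>leavitt_path_algebra \<Gamma> :: ('k, _) module\<^esub> x))"

end

theory Submission
  imports Defs
begin

text \<open>
  Tensor products are right exact, so only the injectivity of \<open>M \<otimes> L \<Gamma> \<rightarrow> N \<otimes> L \<Gamma>\<close> for an
  injective \<open>M \<rightarrow> N\<close> is at stake. For \<open>x \<in> L \<Gamma>\<close> and every sufficiently long path \<open>q\<close>, where
  paths ending in a sink count as infinitely long, \<open>x q\<close> is the image of an element of the path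
  algebra. It is obtained by letting words in vertices, arrows and ghosts act partially on paths;
  the relations of \<open>L \<Gamma>\<close> hold for this action on long paths. Hence every \<open>t \<in> M \<otimes> L \<Gamma>\<close> has
  values \<open>t(q) \<in> M\<close> at long paths \<open>q\<close>, natural in \<open>M\<close>, with \<open>t q = t(q) \<otimes> r\<close> where \<open>r\<close> is the end
  of \<open>q\<close>. If \<open>t(q) = 0\<close> for all long \<open>q\<close>, then \<open>t q = 0\<close> for all long \<open>q\<close>, and
  \<open>t q = \<Sum>\<^sub>e (t q e) e\<^sup>*\<close> propagates this to all \<open>q\<close>, in particular to the vertices, whose sums act
  as local units; thus \<open>t = 0\<close>. So \<open>t\<close> vanishes if and only if its values at long paths do, and
  this condition is reflected by injective maps.
\<close>

text \<open>The obstacle is the relation v = sum of all \<open>e e\<^sup>*\<close>. At the path of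
  length 0 at a vertex v that is not a sink, a ghost has no arrow to strip, so the two sides act
  differently there and the action of the free algebra on paths does not descend to the Leavitt path
  algebra. Each single element of the defining ideal does vanish on all paths beyond some depth.
  Multiplying it on the right by words with ghosts can raise that depth, so the depth is attached to
  an element and never to the ideal. Infinitely many vertices do no harm: the depth of an element
  does not depend on where a path starts, and a local unit needs only finitely many vertices.
  Row-finiteness is what makes the relation above a finite sum, both when it is checked on long
  paths and when q is expanded into the \<open>q e e\<^sup>*\<close>. Injectivity of f is used only
  through f(t(q)) = 0: this is the value at q of the image of t, and it is an element of N itself
  and not of a tensor product.\<close>

no_notation ideal_prod (infixl \<open>\<cdot>\<index>\<close> 80)

section \<open>Tensor products\<close>

text \<open>One functor serves both variables of a tensor: with \<open>apfst f\<close> it is f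
  \<otimes> id, with \<open>apsnd\<close> it becomes right multiplication on the Leavitt
  factor.\<close>

definition frag_map :: "('a \<Rightarrow> 'b) \<Rightarrow> ('a \<Rightarrow>\<^sub>0 int) \<Rightarrow> 'b \<Rightarrow>\<^sub>0 int"
  where "frag_map h = frag_extend (\<lambda>x. frag_of (h x))"

lemma frag_map_simps [simp]:
  "frag_map h 0 = 0"
  "frag_map h (frag_of x) = frag_of (h x)"
  "frag_map h (a + b) = frag_map h a + frag_map h b"
  "frag_map h (a - b) = frag_map h a - frag_map h b"
  "frag_map h (- a) = - frag_map h a"
  by (simp_all add: frag_map_def frag_extend_add frag_extend_diff frag_extend_minus)

lemma keys_frag_map:
  assumes "Poly_Mapping.keys c \<subseteq> S" "h ` S \<subseteq> T"
  shows "Poly_Mapping.keys (frag_map h c) \<subseteq> T"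
  using keys_frag_extend[of "\<lambda>x. frag_of (h x)" c] assms by (fastforce simp: frag_map_def)

section \<open>Formal sums modulo the tensor relations\<close>

locale module_pair = Mod: right_module R M + LMod: left_module R L
  for R :: "('a, 'r) ring_scheme" and M :: "('a, 'm) right_mod" and L :: "('a, 'l) module"
begin

abbreviation K where "K \<equiv> tensor_kernel R M L"
abbreviation FA where "FA \<equiv> free_Abelian_group (carrier M \<times> carrier L)"

lemma tensor_relators_subset: "tensor_relators R M L \<subseteq> carrier FA"
  unfolding tensor_relators_def
  by (auto dest!: subsetD[OF keys_diff] subsetD[OF Poly_Mapping.keys_add]
      simp: Mod.rsmult_closed LMod.smult_closed)

lemma tensor_kernel_subgroup: "subgroup K FA"
  unfolding tensor_kernel_def
  by (rule group.generate_is_subgroup[OF group_free_Abelian_group tensor_relators_subset])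

lemma tensor_kernel_keys: "c \<in> K \<Longrightarrow> Poly_Mapping.keys c \<subseteq> carrier M \<times> carrier L"
  using subsetD[OF subgroup.subset[OF tensor_kernel_subgroup]] by simp

lemma tensor_kernel_0: "0 \<in> K"
  using subgroup.one_closed[OF tensor_kernel_subgroup] by simp

lemma tensor_kernel_add: "c \<in> K \<Longrightarrow> d \<in> K \<Longrightarrow> c + d \<in> K"
  using subgroup.m_closed[OF tensor_kernel_subgroup] by simp

lemma tensor_kernel_minus: "c \<in> K \<Longrightarrow> - c \<in> K"
  using subgroup.m_inv_closed[OF tensor_kernel_subgroup, of c] tensor_kernel_keys by simp

lemma tensor_kernel_diff: "c \<in> K \<Longrightarrow> d \<in> K \<Longrightarrow> c - d \<in> K"
  using tensor_kernel_add[OF _ tensor_kernel_minus, of c d] by simp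

lemma tensor_kernel_add_left:
  "\<lbrakk>m \<in> carrier M; n \<in> carrier M; x \<in> carrier L\<rbrakk>
    \<Longrightarrow> frag_of (m \<oplus>\<^bsub>M\<^esub> n, x) - (frag_of (m, x) + frag_of (n, x)) \<in> K"
  unfolding tensor_kernel_def tensor_relators_def by (rule generate.incl) blast

lemma tensor_kernel_add_right:
  "\<lbrakk>m \<in> carrier M; x \<in> carrier L; y \<in> carrier L\<rbrakk>
    \<Longrightarrow> frag_of (m, x \<oplus>\<^bsub>L\<^esub> y) - (frag_of (m, x) + frag_of (m, y)) \<in> K"
  unfolding tensor_kernel_def tensor_relators_def by (rule generate.incl) blast

lemma tensor_kernel_smult:
  "\<lbrakk>m \<in> carrier M; a \<in> carrier R; x \<in> carrier L\<rbrakk>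
    \<Longrightarrow> frag_of (m \<cdot>\<^bsub>M\<^esub> a, x) - frag_of (m, a \<odot>\<^bsub>L\<^esub> x) \<in> K"
  unfolding tensor_kernel_def tensor_relators_def by (rule generate.incl) blast

lemma tensor_kernel_zero_left: "x \<in> carrier L \<Longrightarrow> frag_of (\<zero>\<^bsub>M\<^esub>, x) \<in> K"
  using tensor_kernel_minus[OF tensor_kernel_add_left[of "\<zero>\<^bsub>M\<^esub>" "\<zero>\<^bsub>M\<^esub>" x]] by simp

lemma tensor_kernel_zero_right: "m \<in> carrier M \<Longrightarrow> frag_of (m, \<zero>\<^bsub>L\<^esub>) \<in> K"
  using tensor_kernel_minus[OF tensor_kernel_add_right[of m "\<zero>\<^bsub>L\<^esub>" "\<zero>\<^bsub>L\<^esub>"]] by simp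

text \<open>The steps \<open>add\<close> and \<open>minus\<close> carry membership in
  \<open>K\<close> along with \<open>P\<close>, because germs are additive only on formal sums
  supported in the two carriers and membership supplies that support.\<close>

lemma tensor_kernel_induct [consumes 1, case_names zero add_left add_right smult add minus]:
  assumes "c \<in> K"
    and "P 0"
    and "\<And>m n x. \<lbrakk>m \<in> carrier M; n \<in> carrier M; x \<in> carrier L\<rbrakk>
      \<Longrightarrow> P (frag_of (m \<oplus>\<^bsub>M\<^esub> n, x) - (frag_of (m, x) + frag_of (n, x)))"
    and "\<And>m x y. \<lbrakk>m \<in> carrier M; x \<in> carrier L; y \<in> carrier L\<rbrakk>
      \<Longrightarrow> P (frag_of (m, x \<oplus>\<^bsub>L\<^esub> y) - (frag_of (m, x) + frag_of (m, y)))"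
    and "\<And>m a x. \<lbrakk>m \<in> carrier M; a \<in> carrier R; x \<in> carrier L\<rbrakk>
      \<Longrightarrow> P (frag_of (m \<cdot>\<^bsub>M\<^esub> a, x) - frag_of (m, a \<odot>\<^bsub>L\<^esub> x))"
    and "\<And>c d. \<lbrakk>c \<in> K; d \<in> K; P c; P d\<rbrakk> \<Longrightarrow> P (c + d)"
    and "\<And>c. \<lbrakk>c \<in> K; P c\<rbrakk> \<Longrightarrow> P (- c)"
  shows "P c"
proof -
  have rel: "P h" if "h \<in> tensor_relators R M L" for h
    using that unfolding tensor_relators_def
    by (elim UnE CollectE exE conjE) (simp_all only: assms(3-5))
  show ?thesis
    using assms(1) unfolding tensor_kernel_def
  proof (induction rule: generate.induct)
    case one
    show ?case using assms(2) by simp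
  next
    case (incl h)
    then show ?case by (rule rel)
  next
    case (inv h)
    have "P h" by (rule rel[OF inv])
    moreover have "h \<in> K"
      unfolding tensor_kernel_def by (rule generate.incl[OF inv])
    \<comment> \<open>The group inverse of \<open>h\<close> is \<open>- h\<close> once
      \<open>h\<close> is supported in the carriers, which membership in \<open>K\<close>
      provides.\<close>
    ultimately show ?case
      using assms(7) tensor_kernel_keys[of h] by simp
  next
    case (eng h1 h2)
    then show ?case using assms(6)[of h1 h2] by (simp add: tensor_kernel_def)
  qed
qed

lemma group_tensor_product: "group (tensor_product R M L)"
  unfolding tensor_product_def
  by (rule comm_group.axioms(2)[OF comm_group.abelian_FactGroup[OF abelian_free_Abelian_group tensor_kernel_subgroup]])

lemma tensor_normal: "K \<lhd> FA"
  using comm_group.subgroup_imp_normal[OF abelian_free_Abelian_group tensor_kernel_subgroup] .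

lemma tensor_coset: "K #>\<^bsub>FA\<^esub> c = (\<lambda>h. h + c) ` K"
  by (auto simp: r_coset_def)

lemma tensor_coset_self: "c \<in> K #>\<^bsub>FA\<^esub> c"
  using tensor_kernel_0 by (force simp: tensor_coset)

lemma tensor_coset_eq_iff: "K #>\<^bsub>FA\<^esub> c = K #>\<^bsub>FA\<^esub> d \<longleftrightarrow> c - d \<in> K"
proof
  assume "K #>\<^bsub>FA\<^esub> c = K #>\<^bsub>FA\<^esub> d"
  then have "c \<in> (\<lambda>h. h + d) ` K"
    using tensor_coset_self[of c] by (simp add: tensor_coset)
  then show "c - d \<in> K" by auto
next
  assume cd: "c - d \<in> K"
  have "h + c \<in> (\<lambda>h. h + d) ` K" if "h \<in> K" for h
    using tensor_kernel_add[OF that cd] by (intro image_eqI[of _ _ "h + (c - d)"]) auto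
  moreover have "h + d \<in> (\<lambda>h. h + c) ` K" if "h \<in> K" for h
    using tensor_kernel_diff[OF that cd] by (intro image_eqI[of _ _ "h - (c - d)"]) auto
  ultimately show "K #>\<^bsub>FA\<^esub> c = K #>\<^bsub>FA\<^esub> d"
    by (auto simp: tensor_coset)
qed

lemma carrier_tensor_product:
  "carrier (tensor_product R M L) = (\<lambda>c. K #>\<^bsub>FA\<^esub> c) ` {c. Poly_Mapping.keys c \<subseteq> carrier M \<times> carrier L}"
  by (auto simp: tensor_product_def FactGroup_def RCOSETS_def)

lemma one_tensor_product: "\<one>\<^bsub>tensor_product R M L\<^esub> = K"
  by (simp add: tensor_product_def)

lemma mult_tensor_product:
  assumes "Poly_Mapping.keys c \<subseteq> carrier M \<times> carrier L" "Poly_Mapping.keys d \<subseteq> carrier M \<times> carrier L"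
  shows "(K #>\<^bsub>FA\<^esub> c) \<otimes>\<^bsub>tensor_product R M L\<^esub> (K #>\<^bsub>FA\<^esub> d) = K #>\<^bsub>FA\<^esub> (c + d)"
  using normal.rcos_sum[OF tensor_normal, of c d] assms by (simp add: tensor_product_def)

end

text \<open>The union in \<open>tensor_map\<close> runs over a whole coset. Once kernel elements go
  to kernel elements, all its members are one and the same coset.\<close>

lemma tensor_map_coset:
  assumes "module_pair R M L" "module_pair R N L"
    and "\<And>h. h \<in> tensor_kernel R M L \<Longrightarrow> frag_map (apfst f) h \<in> tensor_kernel R N L"
  shows "tensor_map R N L f (tensor_kernel R M L #>\<^bsub>free_Abelian_group (carrier M \<times> carrier L)\<^esub> c)
    = tensor_kernel R N L #>\<^bsub>free_Abelian_group (carrier N \<times> carrier L)\<^esub> frag_map (apfst f) c"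
proof -
  interpret M: module_pair R M L by fact
  interpret N: module_pair R N L by fact
  have eq: "frag_extend (\<lambda>(m, x). frag_of (f m, x)) = frag_map (apfst f)"
    unfolding frag_map_def by (rule arg_cong[where f = frag_extend]) auto
  have "N.K #>\<^bsub>N.FA\<^esub> frag_map (apfst f) d = N.K #>\<^bsub>N.FA\<^esub> frag_map (apfst f) c"
    if d: "d \<in> M.K #>\<^bsub>M.FA\<^esub> c" for d
  proof -
    obtain h where "h \<in> M.K" "d = h + c"
      using d by (auto simp: M.tensor_coset)
    then show ?thesis using assms(3)[of h] by (simp add: N.tensor_coset_eq_iff)
  qed
  then show ?thesis
    unfolding tensor_map_def eq using M.tensor_coset_self[of c] by blast
qed

lemma right_module_homD:
  assumes "f \<in> right_module_hom R M N"
  shows "m \<in> carrier M \<Longrightarrow> f m \<in> carrier N"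
    and "\<lbrakk>m \<in> carrier M; n \<in> carrier M\<rbrakk> \<Longrightarrow> f (m \<oplus>\<^bsub>M\<^esub> n) = f m \<oplus>\<^bsub>N\<^esub> f n"
    and "\<lbrakk>m \<in> carrier M; a \<in> carrier R\<rbrakk> \<Longrightarrow> f (m \<cdot>\<^bsub>M\<^esub> a) = f m \<cdot>\<^bsub>N\<^esub> a"
  using assms by (auto simp: right_module_hom_def hom_def)

lemma frag_map_tensor_kernel:
  assumes "module_pair R M L" "module_pair R N L" "f \<in> right_module_hom R M N"
    and "h \<in> tensor_kernel R M L"
  shows "frag_map (apfst f) h \<in> tensor_kernel R N L"
proof -
  interpret M: module_pair R M L by fact
  interpret N: module_pair R N L by fact
  note f = right_module_homD[OF assms(3)]
  show ?thesis
    using assms(4)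
    by (induction rule: M.tensor_kernel_induct)
      (simp_all add: f N.tensor_kernel_0 N.tensor_kernel_add_left N.tensor_kernel_add_right
        N.tensor_kernel_smult N.tensor_kernel_add N.tensor_kernel_minus del: add_uminus_conv_diff)
qed

text \<open>Inverting \<open>g \<otimes> id\<close> modulo the image of \<open>f \<otimes> id\<close> by means of a set-theoretic section of \<open>g\<close>.\<close>

lemma tensor_right_exact:
  fixes R :: "('a, 'r) ring_scheme" and L :: "('a, 'l) module"
    and M1 :: "('a, 'm1) right_mod" and M2 :: "('a, 'm2) right_mod" and M3 :: "('a, 'm3) right_mod"
  assumes P1: "module_pair R M1 L" and P2: "module_pair R M2 L" and P3: "module_pair R M3 L"
    and f: "f \<in> right_module_hom R M1 M2" and g: "g \<in> right_module_hom R M2 M3"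
    and surj: "g ` carrier M2 = carrier M3"
    and ker: "{m \<in> carrier M2. g m = \<zero>\<^bsub>M3\<^esub>} = f ` carrier M1"
    and b: "Poly_Mapping.keys b \<subseteq> carrier M2 \<times> carrier L"
      "frag_map (apfst g) b \<in> tensor_kernel R M3 L"
  obtains a where "Poly_Mapping.keys a \<subseteq> carrier M1 \<times> carrier L"
    "b - frag_map (apfst f) a \<in> tensor_kernel R M2 L"
proof -
  interpret M1: module_pair R M1 L by fact
  interpret M2: module_pair R M2 L by fact
  interpret M3: module_pair R M3 L by fact
  note f = right_module_homD[OF f] and g = right_module_homD[OF g]
  define s where "s = inv_into (carrier M2) g"
  have s: "s n \<in> carrier M2" "g (s n) = n" if "n \<in> carrier M3" for n
    using that surj by (auto simp: s_def inv_into_into f_inv_into_f)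
  let ?S = "frag_map (apfst s) :: ('m3 \<times> 'l \<Rightarrow>\<^sub>0 int) \<Rightarrow> _"
    and ?F = "frag_map (apfst f) :: ('m1 \<times> 'l \<Rightarrow>\<^sub>0 int) \<Rightarrow> _"
  \<comment> \<open>The formal sums that agree modulo the kernel with something coming from
    \<open>M1\<close>. They form a subgroup, and the goal is that it contains
    \<open>b\<close>.\<close>
  define Q where "Q = {b. \<exists>a. Poly_Mapping.keys a \<subseteq> carrier M1 \<times> carrier L \<and> b - ?F a \<in> M2.K}"
  have Q_K: "b \<in> Q" if "b \<in> M2.K" for b
    unfolding Q_def using that by (auto intro!: exI[of _ 0])
  have Q_F: "?F a \<in> Q" if "Poly_Mapping.keys a \<subseteq> carrier M1 \<times> carrier L" for a
    unfolding Q_def using that by (auto intro!: exI[of _ a] simp: M2.tensor_kernel_0)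
  have Q_diff: "b - c \<in> Q" if b: "b \<in> Q" and c: "c \<in> Q" for b c
  proof -
    obtain a a' where "Poly_Mapping.keys a \<subseteq> carrier M1 \<times> carrier L" "b - ?F a \<in> M2.K"
      and "Poly_Mapping.keys a' \<subseteq> carrier M1 \<times> carrier L" "c - ?F a' \<in> M2.K"
      using b c unfolding Q_def by auto
    then show ?thesis unfolding Q_def
      using M2.tensor_kernel_diff[of "b - ?F a" "c - ?F a'"] keys_diff[of a a']
      by (auto intro!: exI[of _ "a - a'"] simp: algebra_simps)
  qed
  have Q_minus: "- b \<in> Q" if "b \<in> Q" for b
    using Q_diff[OF Q_K[OF M2.tensor_kernel_0] that] by simp
  have Q_add: "b + c \<in> Q" if "b \<in> Q" "c \<in> Q" for b c
    using Q_diff[OF that(1) Q_minus[OF that(2)]] by simp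
  \<comment> \<open>The choice of a preimage is immaterial modulo \<open>Q\<close>: two preimages
    differ by an element of the kernel of \<open>g\<close>, hence by some \<open>f d'\<close>.
    Exactness in the middle enters only here.\<close>
  have Q_eq: "frag_of (m, x) - frag_of (n, x) \<in> Q"
    if m: "m \<in> carrier M2" and n: "n \<in> carrier M2" and x: "x \<in> carrier L" and eq: "g m = g n" for m n x
  proof -
    let ?d = "m \<ominus>\<^bsub>M2\<^esub> n"
    have d: "?d \<in> carrier M2" using m n by simp
    have md: "m = ?d \<oplus>\<^bsub>M2\<^esub> n"
      using m n by (simp add: M2.Mod.M.minus_eq M2.Mod.M.a_assoc M2.Mod.M.l_neg)
    then have "g n = g ?d \<oplus>\<^bsub>M3\<^esub> g n"
      using g(2)[OF d n] eq by simp
    then have "g ?d = \<zero>\<^bsub>M3\<^esub>"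
      using g(1)[OF d] g(1)[OF n] M3.Mod.M.add.l_cancel_one'[of "g n" "g ?d"]
        M3.Mod.M.a_comm[of "g n" "g ?d"] by auto
    then obtain d' where d': "d' \<in> carrier M1" "?d = f d'"
      using ker d by blast
    have "frag_of (?d, x) = ?F (frag_of (d', x))"
      using d' by simp
    then have "frag_of (?d, x) \<in> Q"
      using Q_F[of "frag_of (d', x)"] d' x by simp
    then have "frag_of (?d \<oplus>\<^bsub>M2\<^esub> n, x) - (frag_of (?d, x) + frag_of (n, x)) + frag_of (?d, x) \<in> Q"
      using Q_add[OF Q_K[OF M2.tensor_kernel_add_left[OF d n x]]] by blast
    then show ?thesis
      by (simp add: md[symmetric] algebra_simps)
  qed
  \<comment> \<open>The section \<open>s\<close> need not be additive or linear. Each defect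
    compares two elements with the same image under \<open>g\<close>, so \<open>Q_eq\<close> absorbs
    it.\<close>
  have S_K: "?S c \<in> Q" if "c \<in> M3.K" for c
    using that
  proof (induction rule: M3.tensor_kernel_induct)
    case zero
    then show ?case using Q_K[OF M2.tensor_kernel_0] by simp
  next
    case (add_left m n x)
    have "frag_of (s (m \<oplus>\<^bsub>M3\<^esub> n), x) - frag_of (s m \<oplus>\<^bsub>M2\<^esub> s n, x) \<in> Q"
      using add_left by (intro Q_eq) (auto simp: s g)
    from Q_add[OF this Q_K[OF M2.tensor_kernel_add_left[OF s(1)[OF add_left(1)] s(1)[OF add_left(2)] add_left(3)]]]
    show ?case by (simp add: algebra_simps)
  next
    case (add_right m x y)
    from Q_K[OF M2.tensor_kernel_add_right[OF s(1)[OF add_right(1)] add_right(2,3)]]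
    show ?case by simp
  next
    case (smult m a x)
    have "frag_of (s (m \<cdot>\<^bsub>M3\<^esub> a), x) - frag_of (s m \<cdot>\<^bsub>M2\<^esub> a, x) \<in> Q"
      using smult by (intro Q_eq) (auto simp: s g M2.Mod.rsmult_closed M3.Mod.rsmult_closed)
    from Q_add[OF this Q_K[OF M2.tensor_kernel_smult[OF s(1)[OF smult(1)] smult(2,3)]]]
    show ?case by simp
  next
    case (add c d)
    then show ?case using Q_add by simp
  next
    case (minus c)
    then show ?case using Q_minus by simp
  qed
  \<comment> \<open>On a generator (m, x) this compares m with s (g m), another preimage of g
    m.\<close>
  have "b - ?S (frag_map (apfst g) b) \<in> Q"
    using b(1)
  proof (induction b rule: frag_induction)
    case zero
    then show ?case using Q_K[OF M2.tensor_kernel_0] by simp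
  next
    case (one x)
    then show ?case by (cases x) (auto intro!: Q_eq simp: s g)
  next
    case (diff a b)
    then show ?case using Q_diff[OF diff] by (simp add: algebra_simps)
  qed
  from Q_add[OF this S_K[OF b(2)]] have "b \<in> Q" by simp
  then show thesis using that unfolding Q_def by auto
qed

text \<open>The remaining hypothesis speaks of formal sums and kernels, so that the arguments
  special to Leavitt path algebras never meet cosets. Surjectivity comes from lifting generators,
  exactness in the middle from \<open>tensor_right_exact\<close>.\<close>

lemma flat_left_moduleI:
  fixes R :: "('a, 'r) ring_scheme" and L :: "('a, 'l) module"
  assumes L: "left_module R L"
    and inj: "\<And>(M :: ('a, 'm1) right_mod) (N :: ('a, 'm2) right_mod) f c.
      \<lbrakk>unital_right_module R M; unital_right_module R N; f \<in> right_module_hom R M N;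
        inj_on f (carrier M); Poly_Mapping.keys c \<subseteq> carrier M \<times> carrier L;
        frag_map (apfst f) c \<in> tensor_kernel R N L\<rbrakk> \<Longrightarrow> c \<in> tensor_kernel R M L"
  shows "flat_left_module R L TYPE('m1) TYPE('m2) TYPE('m3)"
  unfolding flat_left_module_def
proof (intro conjI allI impI L)
  fix M1 :: "('a, 'm1) right_mod" and M2 :: "('a, 'm2) right_mod" and M3 :: "('a, 'm3) right_mod"
    and f g
  assume H: "unital_right_module R M1 \<and> unital_right_module R M2 \<and> unital_right_module R M3 \<and>
      f \<in> right_module_hom R M1 M2 \<and> g \<in> right_module_hom R M2 M3 \<and>
      short_exact (add_monoid M1) (add_monoid M2) (add_monoid M3) f g"
  then have fhom: "f \<in> right_module_hom R M1 M2" and ghom: "g \<in> right_module_hom R M2 M3"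
    and finj: "inj_on f (carrier M1)" and gsurj: "g ` carrier M2 = carrier M3"
    and ker: "{m \<in> carrier M2. g m = \<zero>\<^bsub>M3\<^esub>} = f ` carrier M1"
    by (auto simp: short_exact_def mon_def epi_def kernel_def)
  have pairs: "module_pair R M1 L" "module_pair R M2 L" "module_pair R M3 L"
    using H L by (auto simp: module_pair_def unital_right_module_def)
  interpret M1: module_pair R M1 L by (fact pairs(1))
  interpret M2: module_pair R M2 L by (fact pairs(2))
  interpret M3: module_pair R M3 L by (fact pairs(3))
  note f = right_module_homD[OF fhom] and g = right_module_homD[OF ghom]
  let ?F = "frag_map (apfst f) :: ('m1 \<times> 'l \<Rightarrow>\<^sub>0 int) \<Rightarrow> _"
    and ?G = "frag_map (apfst g) :: ('m2 \<times> 'l \<Rightarrow>\<^sub>0 int) \<Rightarrow> _"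
  have F_map: "tensor_map R M2 L f (M1.K #>\<^bsub>M1.FA\<^esub> c) = M2.K #>\<^bsub>M2.FA\<^esub> ?F c" for c
    using tensor_map_coset[OF pairs(1,2)] frag_map_tensor_kernel[OF pairs(1,2) fhom] by blast
  have G_map: "tensor_map R M3 L g (M2.K #>\<^bsub>M2.FA\<^esub> c) = M3.K #>\<^bsub>M3.FA\<^esub> ?G c" for c
    using tensor_map_coset[OF pairs(2,3)] frag_map_tensor_kernel[OF pairs(2,3) ghom] by blast
  have F_keys: "Poly_Mapping.keys (?F c) \<subseteq> carrier M2 \<times> carrier L"
    if "Poly_Mapping.keys c \<subseteq> carrier M1 \<times> carrier L" for c
    by (rule keys_frag_map[OF that]) (auto simp: f)
  have G_keys: "Poly_Mapping.keys (?G c) \<subseteq> carrier M3 \<times> carrier L"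
    if "Poly_Mapping.keys c \<subseteq> carrier M2 \<times> carrier L" for c
    by (rule keys_frag_map[OF that]) (auto simp: g)
  have F_hom: "tensor_map R M2 L f \<in> hom (tensor_product R M1 L) (tensor_product R M2 L)"
    by (auto simp: hom_def M1.carrier_tensor_product M2.carrier_tensor_product M1.mult_tensor_product
        M2.mult_tensor_product F_map F_keys)
  have G_hom: "tensor_map R M3 L g \<in> hom (tensor_product R M2 L) (tensor_product R M3 L)"
    by (auto simp: hom_def M2.carrier_tensor_product M3.carrier_tensor_product M2.mult_tensor_product
        M3.mult_tensor_product G_map G_keys)
  have "inj_on (tensor_map R M2 L f) (carrier (tensor_product R M1 L))"
  proof (rule inj_onI)
    fix C D
    assume "C \<in> carrier (tensor_product R M1 L)" "D \<in> carrier (tensor_product R M1 L)"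
      and eq: "tensor_map R M2 L f C = tensor_map R M2 L f D"
    then obtain c d where c: "Poly_Mapping.keys c \<subseteq> carrier M1 \<times> carrier L" "C = M1.K #>\<^bsub>M1.FA\<^esub> c"
      and d: "Poly_Mapping.keys d \<subseteq> carrier M1 \<times> carrier L" "D = M1.K #>\<^bsub>M1.FA\<^esub> d"
      by (auto simp: M1.carrier_tensor_product)
    have "?F (c - d) \<in> M2.K"
      using eq by (simp add: c d F_map M2.tensor_coset_eq_iff)
    then have "c - d \<in> M1.K"
      using inj[of M1 M2 f "c - d"] H finj c d keys_diff[of c d] by blast
    then show "C = D" by (simp add: c d M1.tensor_coset_eq_iff)
  qed
  moreover have "tensor_map R M3 L g ` carrier (tensor_product R M2 L) = carrier (tensor_product R M3 L)"
  proof -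
    have "\<exists>b. Poly_Mapping.keys b \<subseteq> carrier M2 \<times> carrier L \<and> ?G b = c"
      if "Poly_Mapping.keys c \<subseteq> carrier M3 \<times> carrier L" for c
      using that
    proof (induction c rule: frag_induction)
      case zero
      show ?case by (rule exI[of _ 0]) simp
    next
      case (one z)
      then obtain n x where z: "z = (n, x)" "n \<in> carrier M3" "x \<in> carrier L"
        by blast
      then obtain m where "m \<in> carrier M2" "n = g m"
        using gsurj by blast
      with z show ?case by (intro exI[of _ "frag_of (m, x)"]) simp
    next
      case (diff c d)
      then obtain b b' where "Poly_Mapping.keys b \<subseteq> carrier M2 \<times> carrier L \<and> ?G b = c"
        "Poly_Mapping.keys b' \<subseteq> carrier M2 \<times> carrier L \<and> ?G b' = d" by blast
      then show ?case using keys_diff[of b b'] by (intro exI[of _ "b - b'"]) auto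
    qed
    then have "?G ` {c. Poly_Mapping.keys c \<subseteq> carrier M2 \<times> carrier L}
        = {c. Poly_Mapping.keys c \<subseteq> carrier M3 \<times> carrier L}"
      using G_keys by blast
    then show ?thesis
      unfolding M2.carrier_tensor_product M3.carrier_tensor_product image_image G_map
      by (subst image_image[symmetric, of _ ?G]) simp
  qed
  moreover have "kernel (tensor_product R M2 L) (tensor_product R M3 L) (tensor_map R M3 L g)
      = tensor_map R M2 L f ` carrier (tensor_product R M1 L)"
  proof -
    have K0: "M3.K = M3.K #>\<^bsub>M3.FA\<^esub> 0" by (simp add: M3.tensor_coset)
    have ker_iff: "tensor_map R M3 L g (M2.K #>\<^bsub>M2.FA\<^esub> b) = \<one>\<^bsub>tensor_product R M3 L\<^esub> \<longleftrightarrow> ?G b \<in> M3.K" for b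
      unfolding M3.one_tensor_product G_map by (subst (2) K0) (simp add: M3.tensor_coset_eq_iff)
    have FG: "?G (?F a) \<in> M3.K" if "Poly_Mapping.keys a \<subseteq> carrier M1 \<times> carrier L" for a
      using that
    proof (induction a rule: frag_induction)
      case (one z)
      then have "g (f (fst z)) = \<zero>\<^bsub>M3\<^esub>" using ker by auto
      then show ?case using one by (cases z) (simp add: M3.tensor_kernel_zero_left)
    qed (simp_all add: M3.tensor_kernel_0 M3.tensor_kernel_diff)
    have lift: "M2.K #>\<^bsub>M2.FA\<^esub> b \<in> tensor_map R M2 L f ` carrier (tensor_product R M1 L)"
      if b: "Poly_Mapping.keys b \<subseteq> carrier M2 \<times> carrier L" "?G b \<in> M3.K" for b
    proof -
      obtain a where "Poly_Mapping.keys a \<subseteq> carrier M1 \<times> carrier L" "b - ?F a \<in> M2.K"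
        using tensor_right_exact[OF pairs fhom ghom gsurj ker b] .
      then show ?thesis
        by (auto simp: M1.carrier_tensor_product F_map M2.tensor_coset_eq_iff image_iff)
    qed
    show ?thesis
    proof (intro equalityI subsetI)
      fix C
      assume "C \<in> kernel (tensor_product R M2 L) (tensor_product R M3 L) (tensor_map R M3 L g)"
      then obtain b where "Poly_Mapping.keys b \<subseteq> carrier M2 \<times> carrier L" "C = M2.K #>\<^bsub>M2.FA\<^esub> b"
        "tensor_map R M3 L g C = \<one>\<^bsub>tensor_product R M3 L\<^esub>"
        unfolding kernel_def M2.carrier_tensor_product by blast
      then show "C \<in> tensor_map R M2 L f ` carrier (tensor_product R M1 L)"
        using lift[of b] ker_iff[of b] by simp
    next
      fix C
      assume "C \<in> tensor_map R M2 L f ` carrier (tensor_product R M1 L)"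
      then obtain a where a: "Poly_Mapping.keys a \<subseteq> carrier M1 \<times> carrier L"
        "C = tensor_map R M2 L f (M1.K #>\<^bsub>M1.FA\<^esub> a)"
        unfolding M1.carrier_tensor_product by blast
      have "tensor_map R M3 L g C = \<one>\<^bsub>tensor_product R M3 L\<^esub>"
        unfolding a(2) F_map ker_iff by (rule FG[OF a(1)])
      then show "C \<in> kernel (tensor_product R M2 L) (tensor_product R M3 L) (tensor_map R M3 L g)"
        using F_keys[OF a(1)] unfolding kernel_def M2.carrier_tensor_product a(2) F_map by blast
    qed
  qed
  ultimately show "short_exact (tensor_product R M1 L) (tensor_product R M2 L) (tensor_product R M3 L)
      (tensor_map R M2 L f) (tensor_map R M3 L g)"
    using F_hom G_hom
    by (simp add: short_exact_def mon_def epi_def M1.group_tensor_product M2.group_tensor_product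
        M3.group_tensor_product)
qed


section \<open>Partial products and their bilinear extensions\<close>

text \<open>An element is the sum of its monomials. Keeping the support of both summands inside
  \<open>S\<close> preserves facts about basis elements, such as being a path.\<close>

lemma poly_mapping_induct_keys [consumes 1, case_names zero single add]:
  fixes a :: "'p \<Rightarrow>\<^sub>0 'k::comm_monoid_add"
  assumes "Poly_Mapping.keys a \<subseteq> S" and "P 0" and "\<And>x c. x \<in> S \<Longrightarrow> P (Poly_Mapping.single x c)"
    and "\<And>a b. \<lbrakk>Poly_Mapping.keys a \<subseteq> S; Poly_Mapping.keys b \<subseteq> S; P a; P b\<rbrakk> \<Longrightarrow> P (a + b)"
  shows "P a"
proof -
  have sum: "P (\<Sum>x\<in>V. Poly_Mapping.single x (Poly_Mapping.lookup a x)) \<and>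
      Poly_Mapping.keys (\<Sum>x\<in>V. Poly_Mapping.single x (Poly_Mapping.lookup a x)) \<subseteq> S"
    if "finite V" "V \<subseteq> S" for V
    using that
  proof (induction rule: finite_induct)
    case (insert x V)
    then have "Poly_Mapping.keys (Poly_Mapping.single x (Poly_Mapping.lookup a x)) \<subseteq> S"
      by (simp add: keys_single)
    with insert show ?case
      using Poly_Mapping.keys_add[of "Poly_Mapping.single x (Poly_Mapping.lookup a x)"
          "\<Sum>x\<in>V. Poly_Mapping.single x (Poly_Mapping.lookup a x)"]
      by (auto intro!: assms(3,4))
  qed (simp add: assms(2))
  have "(\<Sum>x\<in>Poly_Mapping.keys a. Poly_Mapping.single x (Poly_Mapping.lookup a x)) = a"
  proof (rule poly_mapping_eqI)
    fix y
    have "(\<Sum>x\<in>Poly_Mapping.keys a. Poly_Mapping.lookup a x when x = y) = Poly_Mapping.lookup a y"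
      by (cases "y \<in> Poly_Mapping.keys a") (auto simp: when_def in_keys_iff)
    then show "Poly_Mapping.lookup (\<Sum>x\<in>Poly_Mapping.keys a. Poly_Mapping.single x (Poly_Mapping.lookup a x)) y
        = Poly_Mapping.lookup a y"
      by (simp add: lookup_sum lookup_single)
  qed
  with sum[OF finite_keys assms(1)] show ?thesis by simp
qed

lemma keys_add_subset:
  "Poly_Mapping.keys a \<subseteq> S \<Longrightarrow> Poly_Mapping.keys b \<subseteq> S \<Longrightarrow> Poly_Mapping.keys (a + b) \<subseteq> S"
  using Poly_Mapping.keys_add[of a b] by blast

lemma keys_diff_subset:
  "Poly_Mapping.keys a \<subseteq> S \<Longrightarrow> Poly_Mapping.keys b \<subseteq> S \<Longrightarrow> Poly_Mapping.keys (a - b) \<subseteq> S"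
  using keys_diff[of a b] by blast

lemma keys_sum_subset:
  assumes "\<And>x. x \<in> V \<Longrightarrow> Poly_Mapping.keys (f x) \<subseteq> S"
  shows "Poly_Mapping.keys (sum f V) \<subseteq> S"
  using assms
proof (induction V rule: infinite_finite_induct)
  case (insert x V)
  then show ?case using Poly_Mapping.keys_add[of "f x" "sum f V"] by fastforce
qed auto

definition opt_single :: "'r option \<Rightarrow> 'k \<Rightarrow> 'r \<Rightarrow>\<^sub>0 'k::field"
  where "opt_single z c = (case z of None \<Rightarrow> 0 | Some z \<Rightarrow> Poly_Mapping.single z c)"

lemma opt_single_simps [simp]:
  "opt_single None c = 0"
  "opt_single (Some z) c = Poly_Mapping.single z c"
  "opt_single y 0 = 0"
  by (simp_all add: opt_single_def split: option.split)

lemma opt_single_add: "opt_single z (c + d) = opt_single z c + opt_single z d"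
  by (simp add: opt_single_def single_add split: option.split)

text \<open>Three independent index types let one construction cover the product of paths, the
  concatenation of words and the action of words on paths.\<close>

definition bilinear_ext ::
    "('p \<Rightarrow> 'q \<Rightarrow> 'r option) \<Rightarrow> ('p \<Rightarrow>\<^sub>0 'k::field) \<Rightarrow> ('q \<Rightarrow>\<^sub>0 'k) \<Rightarrow> 'r \<Rightarrow>\<^sub>0 'k"
  where "bilinear_ext f a b = (\<Sum>x\<in>Poly_Mapping.keys a. \<Sum>y\<in>Poly_Mapping.keys b.
    opt_single (f x y) (Poly_Mapping.lookup a x * Poly_Mapping.lookup b y))"

text \<open>Cancellation can make the support of a sum smaller than the union of the supports.
  Summing over a common larger set reduces additivity to a termwise identity.\<close>

lemma bilinear_ext_superset:
  assumes "finite V" "Poly_Mapping.keys a \<subseteq> V" "finite Y" "Poly_Mapping.keys b \<subseteq> Y"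
  shows "bilinear_ext f a b =
    (\<Sum>x\<in>V. \<Sum>y\<in>Y. opt_single (f x y) (Poly_Mapping.lookup a x * Poly_Mapping.lookup b y))"
proof -
  have "bilinear_ext f a b = (\<Sum>x\<in>Poly_Mapping.keys a. \<Sum>y\<in>Y.
      opt_single (f x y) (Poly_Mapping.lookup a x * Poly_Mapping.lookup b y))"
    unfolding bilinear_ext_def
    by (intro sum.cong refl sum.mono_neutral_left assms) (simp add: in_keys_iff)
  also have "\<dots> = (\<Sum>x\<in>V. \<Sum>y\<in>Y. opt_single (f x y) (Poly_Mapping.lookup a x * Poly_Mapping.lookup b y))"
    by (intro sum.mono_neutral_left assms) (simp add: in_keys_iff)
  finally show ?thesis .
qed

lemma bilinear_ext_single [simp]:
  "bilinear_ext f (Poly_Mapping.single x c) (Poly_Mapping.single y d) = opt_single (f x y) (c * d)"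
  by (subst bilinear_ext_superset[of "{x}" _ "{y}"]) auto

lemma bilinear_ext_zero [simp]: "bilinear_ext f 0 b = 0" "bilinear_ext f a 0 = 0"
  by (simp_all add: bilinear_ext_def)

lemma bilinear_ext_add_left: "bilinear_ext f (a + a') b = bilinear_ext f a b + bilinear_ext f a' b"
proof -
  let ?V = "Poly_Mapping.keys a \<union> Poly_Mapping.keys a'"
  have "Poly_Mapping.keys (a + a') \<subseteq> ?V" by (rule Poly_Mapping.keys_add)
  then show ?thesis
    by (subst (1 2 3) bilinear_ext_superset[of ?V _ "Poly_Mapping.keys b"])
      (simp_all add: lookup_add distrib_right opt_single_add sum.distrib)
qed

lemma bilinear_ext_add_right: "bilinear_ext f a (b + b') = bilinear_ext f a b + bilinear_ext f a b'"
proof -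
  let ?Y = "Poly_Mapping.keys b \<union> Poly_Mapping.keys b'"
  have "Poly_Mapping.keys (b + b') \<subseteq> ?Y" by (rule Poly_Mapping.keys_add)
  then show ?thesis
    by (subst (1 2 3) bilinear_ext_superset[of "Poly_Mapping.keys a" _ ?Y])
      (simp_all add: lookup_add distrib_left opt_single_add sum.distrib)
qed

lemma bilinear_ext_minus_left: "bilinear_ext f (- a) b = - bilinear_ext f a b"
  using bilinear_ext_add_left[of f a "- a" b] by (simp add: eq_neg_iff_add_eq_0 add.commute)

lemma bilinear_ext_diff_left: "bilinear_ext f (a - a') b = bilinear_ext f a b - bilinear_ext f a' b"
  using bilinear_ext_add_left[of f a "- a'" b] by (simp add: bilinear_ext_minus_left)

lemma bilinear_ext_sum_left: "bilinear_ext f (sum g V) b = (\<Sum>x\<in>V. bilinear_ext f (g x) b)"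
  by (induction V rule: infinite_finite_induct) (simp_all add: bilinear_ext_add_left)

lemma bilinear_ext_sum_right: "bilinear_ext f a (sum g V) = (\<Sum>x\<in>V. bilinear_ext f a (g x))"
  by (induction V rule: infinite_finite_induct) (simp_all add: bilinear_ext_add_right)

lemma keys_bilinear_ext:
  assumes "Poly_Mapping.keys a \<subseteq> S" "Poly_Mapping.keys b \<subseteq> T"
    and "\<And>x y z. \<lbrakk>x \<in> S; y \<in> T; f x y = Some z\<rbrakk> \<Longrightarrow> z \<in> U"
  shows "Poly_Mapping.keys (bilinear_ext f a b) \<subseteq> U"
  unfolding bilinear_ext_def
proof (intro keys_sum_subset)
  fix x y
  assume "x \<in> Poly_Mapping.keys a" "y \<in> Poly_Mapping.keys b"
  then show "Poly_Mapping.keys (opt_single (f x y) (Poly_Mapping.lookup a x * Poly_Mapping.lookup b y)) \<subseteq> U"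
    using assms(1,2) assms(3)[of x y] by (cases "f x y") auto
qed

text \<open>With four possibly different partial products this is both associativity of a ring and
  the law for a module action. As an undefined product counts as 0, the two bracketings must also be
  undefined together.\<close>

lemma bilinear_ext_assoc:
  assumes "Poly_Mapping.keys a \<subseteq> S" "Poly_Mapping.keys b \<subseteq> T" "Poly_Mapping.keys c \<subseteq> U"
    and fg: "\<And>x y z. \<lbrakk>x \<in> S; y \<in> T; z \<in> U\<rbrakk>
      \<Longrightarrow> Option.bind (f x y) (\<lambda>u. g u z) = Option.bind (h y z) (\<lambda>u. k x u)"
  shows "bilinear_ext g (bilinear_ext f a b) c = bilinear_ext k a (bilinear_ext h b c)"
  using assms(1)
proof (induction a rule: poly_mapping_induct_keys)
  case (single x r)
  show ?case
    using assms(2)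
  proof (induction b rule: poly_mapping_induct_keys)
    case (single y s)
    show ?case
      using assms(3)
    proof (induction c rule: poly_mapping_induct_keys)
      case (single z t)
      show ?case
        using fg[OF \<open>x \<in> S\<close> \<open>y \<in> T\<close> \<open>z \<in> U\<close>]
        by (cases "f x y"; cases "h y z") (simp_all add: mult.assoc split: option.splits)
    qed (simp_all add: bilinear_ext_add_right)
  qed (simp_all add: bilinear_ext_add_left bilinear_ext_add_right)
qed (simp_all add: bilinear_ext_add_left)

abbreviation scale :: "'k::field \<Rightarrow> ('p \<Rightarrow>\<^sub>0 'k) \<Rightarrow> 'p \<Rightarrow>\<^sub>0 'k"
  where "scale c \<equiv> Poly_Mapping.map ((*) c)"

lemma lookup_scale [simp]: "Poly_Mapping.lookup (scale c a) x = c * Poly_Mapping.lookup a x"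
  by (simp add: Poly_Mapping.map.rep_eq when_def)

lemma scale_zero [simp]: "scale c 0 = 0"
  by (rule poly_mapping_eqI) simp

lemma scale_minus_one: "scale (- 1) a = - a"
  by (rule poly_mapping_eqI) simp

lemma scale_diff: "scale c (a - b) = scale c a - scale c b"
  by (rule poly_mapping_eqI) (simp add: lookup_minus algebra_simps)

lemma scale_opt_single [simp]: "scale c (opt_single z d) = opt_single z (c * d)"
  by (rule poly_mapping_eqI) (auto simp: opt_single_def lookup_single when_def split: option.split)

lemma scale_single: "scale c (Poly_Mapping.single x d) = Poly_Mapping.single x (c * d)"
  using scale_opt_single[of c "Some x" d] by simp

lemma keys_scale: "Poly_Mapping.keys (scale c a) \<subseteq> Poly_Mapping.keys a"
  by (auto simp: in_keys_iff)

lemma bilinear_ext_scale_left: "bilinear_ext f (scale c a) b = scale c (bilinear_ext f a b)"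
proof -
  have scale_add: "scale c (a + b) = scale c a + scale c b" for a b :: "'x \<Rightarrow>\<^sub>0 'b"
    by (rule poly_mapping_eqI) (simp add: lookup_add algebra_simps)
  show ?thesis
    using subset_UNIV[of "Poly_Mapping.keys a"]
  proof (induction a rule: poly_mapping_induct_keys)
    case (single x r)
    show ?case
      using subset_UNIV[of "Poly_Mapping.keys b"]
      by (induction b rule: poly_mapping_induct_keys)
        (simp_all add: scale_single mult.assoc bilinear_ext_add_right scale_add)
  qed (simp_all add: scale_add bilinear_ext_add_left)
qed

definition linear_ext :: "('p \<Rightarrow> 'q) \<Rightarrow> ('p \<Rightarrow>\<^sub>0 'k::field) \<Rightarrow> 'q \<Rightarrow>\<^sub>0 'k"
  where "linear_ext h a = (\<Sum>x\<in>Poly_Mapping.keys a. Poly_Mapping.single (h x) (Poly_Mapping.lookup a x))"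

text \<open>A linear map is a bilinear one whose second argument is frozen at the basis vector of a
  one-dimensional space, so additivity and support bounds are inherited.\<close>

lemma linear_ext_eq_bilinear_ext:
  "linear_ext h a = bilinear_ext (\<lambda>x _. Some (h x)) a (Poly_Mapping.single () 1)"
  by (simp add: linear_ext_def bilinear_ext_def)

lemma linear_ext_zero [simp]: "linear_ext h 0 = 0"
  by (simp add: linear_ext_eq_bilinear_ext)

lemma linear_ext_single [simp]: "linear_ext h (Poly_Mapping.single x c) = Poly_Mapping.single (h x) c"
  by (simp add: linear_ext_eq_bilinear_ext)

lemma linear_ext_add: "linear_ext h (a + b) = linear_ext h a + linear_ext h b"
  by (simp add: linear_ext_eq_bilinear_ext bilinear_ext_add_left)

lemma keys_linear_ext:
  "Poly_Mapping.keys a \<subseteq> S \<Longrightarrow> h ` S \<subseteq> T \<Longrightarrow> Poly_Mapping.keys (linear_ext h a) \<subseteq> T"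
  unfolding linear_ext_eq_bilinear_ext by (erule keys_bilinear_ext[OF _ subset_UNIV]) auto


section \<open>Ideals and quotients of algebras with a multiplicative basis\<close>

lemma basis_algebra_simps [simp]:
  "a \<in> carrier (basis_algebra P f) \<longleftrightarrow> Poly_Mapping.keys a \<subseteq> P"
  "a \<otimes>\<^bsub>basis_algebra P f\<^esub> b = bilinear_ext f a b"
  "a \<oplus>\<^bsub>basis_algebra P f\<^esub> b = a + b"
  "\<zero>\<^bsub>basis_algebra P f\<^esub> = 0"
  "c \<odot>\<^bsub>basis_algebra P f\<^esub> a = scale c a"
  by (simp_all add: basis_algebra_def bilinear_ext_def opt_single_def)

locale basis_ring =
  fixes P :: "'p set" and prd :: "'p \<Rightarrow> 'p \<Rightarrow> 'p option"
  assumes prd_closed: "\<lbrakk>x \<in> P; y \<in> P; prd x y = Some z\<rbrakk> \<Longrightarrow> z \<in> P"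
    and prd_assoc: "\<lbrakk>x \<in> P; y \<in> P; z \<in> P\<rbrakk>
      \<Longrightarrow> Option.bind (prd x y) (\<lambda>u. prd u z) = Option.bind (prd y z) (\<lambda>u. prd x u)"
begin

lemma keys_mult:
  "\<lbrakk>Poly_Mapping.keys a \<subseteq> P; Poly_Mapping.keys b \<subseteq> P\<rbrakk>
    \<Longrightarrow> Poly_Mapping.keys (bilinear_ext prd a b) \<subseteq> P"
  by (rule keys_bilinear_ext) (auto intro: prd_closed)

lemma mult_assoc:
  "\<lbrakk>Poly_Mapping.keys a \<subseteq> P; Poly_Mapping.keys b \<subseteq> P; Poly_Mapping.keys c \<subseteq> P\<rbrakk>
    \<Longrightarrow> bilinear_ext prd (bilinear_ext prd a b) c = bilinear_ext prd a (bilinear_ext prd b c)"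
  by (rule bilinear_ext_assoc[where S = P and T = P and U = P]) (auto intro: prd_assoc)

lemma nonunital_ring_basis_algebra:
  "nonunital_ring (basis_algebra P prd :: ('k::field, 'p \<Rightarrow>\<^sub>0 'k) module)"
proof (intro nonunital_ring.intro nonunital_ring_axioms.intro)
  show "abelian_group (basis_algebra P prd :: ('k::field, 'p \<Rightarrow>\<^sub>0 'k) module)"
  proof (rule abelian_groupI)
    fix a :: "'p \<Rightarrow>\<^sub>0 'k"
    assume "a \<in> carrier (basis_algebra P prd)"
    then show "\<exists>b\<in>carrier (basis_algebra P prd). b \<oplus>\<^bsub>basis_algebra P prd\<^esub> a = \<zero>\<^bsub>basis_algebra P prd\<^esub>"
      by (intro bexI[of _ "- a"]) (simp_all add: keys_minus)
  qed (auto simp: add_ac dest: subsetD[OF Poly_Mapping.keys_add])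
qed (simp_all add: keys_mult mult_assoc bilinear_ext_add_left bilinear_ext_add_right)

end

locale basis_ideal = basis_ring P prd
  for P :: "'p set" and prd +
  fixes I :: "('p \<Rightarrow>\<^sub>0 'k::field) set"
  assumes ideal_keys: "a \<in> I \<Longrightarrow> Poly_Mapping.keys a \<subseteq> P"
    and ideal_zero: "0 \<in> I"
    and ideal_add: "\<lbrakk>a \<in> I; b \<in> I\<rbrakk> \<Longrightarrow> a + b \<in> I"
    and ideal_scale: "a \<in> I \<Longrightarrow> scale c a \<in> I"
    and ideal_lmult: "\<lbrakk>Poly_Mapping.keys r \<subseteq> P; a \<in> I\<rbrakk> \<Longrightarrow> bilinear_ext prd r a \<in> I"
    and ideal_rmult: "\<lbrakk>a \<in> I; Poly_Mapping.keys r \<subseteq> P\<rbrakk> \<Longrightarrow> bilinear_ext prd a r \<in> I"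
begin

abbreviation B :: "('k, 'p \<Rightarrow>\<^sub>0 'k) module" where "B \<equiv> basis_algebra P prd"
abbreviation Q :: "('k, ('p \<Rightarrow>\<^sub>0 'k) set) module" where "Q \<equiv> quotient_algebra B I"

lemma ideal_minus: "a \<in> I \<Longrightarrow> - a \<in> I"
  using ideal_scale[of a "- 1"] by (simp add: scale_minus_one)

lemma ideal_diff: "\<lbrakk>a \<in> I; b \<in> I\<rbrakk> \<Longrightarrow> a - b \<in> I"
  using ideal_add[OF _ ideal_minus, of a b] by simp

lemma coset_eq_image: "I +>\<^bsub>B\<^esub> a = (\<lambda>h. h + a) ` I"
  by (auto simp: a_r_coset_def r_coset_def)

lemma coset_eq_iff: "I +>\<^bsub>B\<^esub> a = I +>\<^bsub>B\<^esub> b \<longleftrightarrow> a - b \<in> I"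
proof
  assume "I +>\<^bsub>B\<^esub> a = I +>\<^bsub>B\<^esub> b"
  moreover have "a \<in> I +>\<^bsub>B\<^esub> a" using ideal_zero by (force simp: coset_eq_image)
  ultimately have "a \<in> (\<lambda>h. h + b) ` I" by (simp add: coset_eq_image)
  then show "a - b \<in> I" by auto
next
  assume ab: "a - b \<in> I"
  have "h + a \<in> (\<lambda>h. h + b) ` I" if "h \<in> I" for h
    using ideal_add[OF that ab] by (intro image_eqI[of _ _ "h + (a - b)"]) auto
  moreover have "h + b \<in> (\<lambda>h. h + a) ` I" if "h \<in> I" for h
    using ideal_diff[OF that ab] by (intro image_eqI[of _ _ "h - (a - b)"]) auto
  ultimately show "I +>\<^bsub>B\<^esub> a = I +>\<^bsub>B\<^esub> b"
    by (auto simp: coset_eq_image)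
qed

lemma coset_cong_scale: "I +>\<^bsub>B\<^esub> a = I +>\<^bsub>B\<^esub> b \<Longrightarrow> I +>\<^bsub>B\<^esub> scale c a = I +>\<^bsub>B\<^esub> scale c b"
  using ideal_scale[of "a - b" c] by (simp add: coset_eq_iff scale_diff)

lemma carrier_quotient: "carrier Q = (\<lambda>a. I +>\<^bsub>B\<^esub> a) ` {a. Poly_Mapping.keys a \<subseteq> P}"
  by (auto simp: quotient_algebra_def ring.defs FactRing_def A_RCOSETS_def RCOSETS_def a_r_coset_def)

lemma coset_closed: "Poly_Mapping.keys a \<subseteq> P \<Longrightarrow> I +>\<^bsub>B\<^esub> a \<in> carrier Q"
  by (auto simp: carrier_quotient)

lemma zero_quotient: "\<zero>\<^bsub>Q\<^esub> = I +>\<^bsub>B\<^esub> 0"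
  by (simp add: quotient_algebra_def ring.defs FactRing_def coset_eq_image)

lemma add_quotient: "(I +>\<^bsub>B\<^esub> a) \<oplus>\<^bsub>Q\<^esub> (I +>\<^bsub>B\<^esub> b) = I +>\<^bsub>B\<^esub> (a + b)"
proof -
  have "(I +>\<^bsub>B\<^esub> a) \<oplus>\<^bsub>Q\<^esub> (I +>\<^bsub>B\<^esub> b) = {h + a + (h' + b) | h h'. h \<in> I \<and> h' \<in> I}"
    by (auto simp: quotient_algebra_def ring.defs FactRing_def set_add_def set_mult_def coset_eq_image)
  also have "\<dots> = (\<lambda>h. h + (a + b)) ` I"
  proof (intro equalityI subsetI)
    fix x assume "x \<in> {h + a + (h' + b) | h h'. h \<in> I \<and> h' \<in> I}"
    then obtain h h' where h: "x = h + a + (h' + b)" "h \<in> I" "h' \<in> I" by blast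
    then show "x \<in> (\<lambda>h. h + (a + b)) ` I"
      using ideal_add[OF h(2,3)] by (intro image_eqI[of _ _ "h + h'"]) (simp_all add: algebra_simps)
  next
    fix x assume "x \<in> (\<lambda>h. h + (a + b)) ` I"
    then obtain h where "x = h + a + (0 + b)" "h \<in> I" by (auto simp: algebra_simps)
    then show "x \<in> {h + a + (h' + b) | h h'. h \<in> I \<and> h' \<in> I}"
      using ideal_zero by blast
  qed
  finally show ?thesis by (simp add: coset_eq_image)
qed

text \<open>A product of cosets is a union over representatives. By (h + a)(h' + b) - a b = h (h' +
  b) + a h' they all contribute the same coset.\<close>

lemma mult_quotient:
  assumes "Poly_Mapping.keys a \<subseteq> P" "Poly_Mapping.keys b \<subseteq> P"
  shows "(I +>\<^bsub>B\<^esub> a) \<otimes>\<^bsub>Q\<^esub> (I +>\<^bsub>B\<^esub> b) = I +>\<^bsub>B\<^esub> bilinear_ext prd a b"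
proof -
  have "I +>\<^bsub>B\<^esub> bilinear_ext prd (h + a) (h' + b) = I +>\<^bsub>B\<^esub> bilinear_ext prd a b"
    if h: "h \<in> I" "h' \<in> I" for h h'
  proof -
    have "bilinear_ext prd h (h' + b) \<in> I"
      using h assms Poly_Mapping.keys_add[of h' b] ideal_keys[of h'] by (intro ideal_rmult) auto
    moreover have "bilinear_ext prd a h' \<in> I"
      using h assms by (intro ideal_lmult)
    ultimately have "bilinear_ext prd h (h' + b) + bilinear_ext prd a h' \<in> I"
      by (rule ideal_add)
    then show ?thesis
      by (simp add: coset_eq_iff bilinear_ext_add_left bilinear_ext_add_right algebra_simps)
  qed
  moreover have "(I +>\<^bsub>B\<^esub> a) \<otimes>\<^bsub>Q\<^esub> (I +>\<^bsub>B\<^esub> b) =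
      (\<Union>h\<in>I. \<Union>h'\<in>I. I +>\<^bsub>B\<^esub> bilinear_ext prd (h + a) (h' + b))"
    by (simp add: quotient_algebra_def ring.defs FactRing_def rcoset_mult_def coset_eq_image)
  ultimately show ?thesis
    using ideal_zero by auto
qed

lemma nonunital_ring_quotient: "nonunital_ring Q"
proof (intro nonunital_ring.intro nonunital_ring_axioms.intro)
  show "abelian_group Q"
  proof (rule abelian_groupI)
    fix V Y
    assume "V \<in> carrier Q" "Y \<in> carrier Q"
    then obtain x y where "Poly_Mapping.keys x \<subseteq> P" "V = I +>\<^bsub>B\<^esub> x"
      "Poly_Mapping.keys y \<subseteq> P" "Y = I +>\<^bsub>B\<^esub> y"
      by (auto simp: carrier_quotient)
    then show "V \<oplus>\<^bsub>Q\<^esub> Y \<in> carrier Q"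
      using Poly_Mapping.keys_add[of x y] by (auto simp: add_quotient intro!: coset_closed)
  next
    fix V
    assume "V \<in> carrier Q"
    then obtain x where "Poly_Mapping.keys x \<subseteq> P" "V = I +>\<^bsub>B\<^esub> x"
      by (auto simp: carrier_quotient)
    then show "\<exists>Y\<in>carrier Q. Y \<oplus>\<^bsub>Q\<^esub> V = \<zero>\<^bsub>Q\<^esub>"
      by (intro bexI[of _ "I +>\<^bsub>B\<^esub> (- x)"]) (simp_all add: add_quotient zero_quotient coset_closed keys_minus)
  qed (auto simp: carrier_quotient add_quotient zero_quotient add_ac)
qed (auto simp: carrier_quotient mult_quotient add_quotient keys_mult mult_assoc bilinear_ext_add_left
    bilinear_ext_add_right keys_add_subset)

end


section \<open>Leavitt path algebras acting on long paths\<close>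

definition path_target :: "('v, 'e) pre_digraph \<Rightarrow> 'v \<times> 'e list \<Rightarrow> 'v"
  where "path_target \<Gamma> q = last (pre_digraph.awalk_verts \<Gamma> (fst q) (snd q))"

text \<open>On a path of positive length exactly one ghost is defined, that of the first arrow, and
  the same arrow puts back what it stripped. On a path of length 0 no ghost is defined, and this is
  where the sum relation fails at vertices that are not sinks.\<close>

primrec gen_act :: "('v, 'e) pre_digraph \<Rightarrow> ('v, 'e) leavitt_gen \<Rightarrow> 'v \<times> 'e list \<Rightarrow> ('v \<times> 'e list) option"
  where
    "gen_act \<Gamma> (Vertex v) q = (if v = fst q then Some q else None)"
  | "gen_act \<Gamma> (Arrow e) q = (if head \<Gamma> e = fst q then Some (tail \<Gamma> e, e # snd q) else None)"
  | "gen_act \<Gamma> (Ghost e) q =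
      (case snd q of [] \<Rightarrow> None | f # p \<Rightarrow> if f = e then Some (head \<Gamma> e, p) else None)"

primrec word_act :: "('v, 'e) pre_digraph \<Rightarrow> ('v, 'e) leavitt_gen list \<Rightarrow> 'v \<times> 'e list \<Rightarrow> ('v \<times> 'e list) option"
  where
    "word_act \<Gamma> [] q = Some q"
  | "word_act \<Gamma> (g # w) q = Option.bind (word_act \<Gamma> w q) (gen_act \<Gamma> g)"

text \<open>A path that ends in a sink cannot be prolonged and counts as infinitely long.\<close>

definition deep :: "('v, 'e) pre_digraph \<Rightarrow> nat \<Rightarrow> 'v \<times> 'e list \<Rightarrow> bool"
  where "deep \<Gamma> n q \<longleftrightarrow> n \<le> length (snd q) \<or> out_arcs \<Gamma> (path_target \<Gamma> q) = {}"

lemma deep_mono: "deep \<Gamma> n q \<Longrightarrow> m \<le> n \<Longrightarrow> deep \<Gamma> m q"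
  by (auto simp: deep_def)

lemma word_act_append: "word_act \<Gamma> (v @ w) q = Option.bind (word_act \<Gamma> w q) (word_act \<Gamma> v)"
  by (induction v) (auto split: bind_splits)

lemma path_target_simps [simp]:
  "path_target \<Gamma> (u, []) = u"
  "path_target \<Gamma> (u, e # p) = path_target \<Gamma> (head \<Gamma> e, p)"
  by (simp_all add: path_target_def pre_digraph.awalk_verts.simps pre_digraph.awalk_verts_non_Nil)

lemma path_target_append: "path_target \<Gamma> (u, p @ q) = path_target \<Gamma> (path_target \<Gamma> (u, p), q)"
  by (induction p arbitrary: u) simp_all

lemma path_prod_eq:
  "path_prod \<Gamma> p q = (if path_target \<Gamma> p = fst q then Some (fst p, snd p @ snd q) else None)"
  by (simp add: path_prod_def path_target_def)

section \<open>Paths and the effect of words on them\<close>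

context wf_digraph
begin

lemma paths_simps [simp]:
  "(u, []) \<in> paths G \<longleftrightarrow> u \<in> verts G"
  "(u, e # p) \<in> paths G \<longleftrightarrow> e \<in> arcs G \<and> u = tail G e \<and> (head G e, p) \<in> paths G"
  by (auto simp: paths_def awalk_Nil_iff awalk_Cons_iff)

lemma paths_append:
  "(u, p @ q) \<in> paths G \<longleftrightarrow> (u, p) \<in> paths G \<and> (path_target G (u, p), q) \<in> paths G"
proof (induction p arbitrary: u)
  case Nil
  then show ?case by (cases q) auto
qed auto

lemma paths_source: "q \<in> paths G \<Longrightarrow> fst q \<in> verts G"
  by (cases q; cases "snd q") auto

lemma paths_target: "q \<in> paths G \<Longrightarrow> path_target G q \<in> verts G"
proof (induction "snd q" arbitrary: q)
  case Nil
  then show ?case by (cases q) auto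
next
  case (Cons e p)
  then show ?case by (cases q) (metis paths_simps(2) path_target_simps(2) snd_conv)
qed

lemma basis_ring_paths: "basis_ring (paths G) (path_prod G)"
proof
  fix x y z
  assume "x \<in> paths G" "y \<in> paths G" "path_prod G x y = Some z"
  then show "z \<in> paths G"
    by (cases x; cases y) (auto simp: path_prod_eq paths_append split: if_splits)
next
  fix x y z
  show "Option.bind (path_prod G x y) (\<lambda>u. path_prod G u z) = Option.bind (path_prod G y z) (\<lambda>u. path_prod G x u)"
    by (cases x; cases y; cases z) (auto simp: path_prod_eq path_target_append)
qed

text \<open>A letter costs at most one arrow. Since it works at the beginning of the path, the end
  is untouched, and a path ending in a sink keeps doing so.\<close>

lemma gen_act_path:
  assumes "g \<in> leavitt_gens G" "q \<in> paths G" "gen_act G g q = Some q'"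
  shows "q' \<in> paths G \<and> path_target G q' = path_target G q \<and> length (snd q) \<le> Suc (length (snd q'))"
  using assms by (cases q; cases g) (auto simp: leavitt_gens_def split: if_splits list.splits)

lemma word_act_path:
  assumes "w \<in> lists (leavitt_gens G)" "q \<in> paths G" "word_act G w q = Some q'"
  shows "q' \<in> paths G \<and> path_target G q' = path_target G q \<and>
    length (snd q) \<le> length w + length (snd q')"
  using assms
proof (induction w arbitrary: q')
  case (Cons g w)
  then obtain q'' where q'': "word_act G w q = Some q''" "gen_act G g q'' = Some q'"
    by (auto simp: bind_eq_Some_conv)
  with Cons have "q'' \<in> paths G \<and> path_target G q'' = path_target G q \<and>
    length (snd q) \<le> length w + length (snd q'')" by auto
  moreover have "g \<in> leavitt_gens G" by (rule Cons.hyps(1))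
  ultimately show ?case using gen_act_path[of g q'' q'] q'' by fastforce
qed auto

text \<open>Elements of the path algebra act by left multiplication on all paths, short ones
  included, because their words contain no ghosts.\<close>

lemma word_act_path_word:
  assumes "p \<in> paths G" "q \<in> paths G"
  shows "word_act G (path_word p) q = path_prod G p q"
proof -
  \<comment> \<open>Only for nonempty lists: the empty word acts as the identity on every path,
    whereas the path (u, []) has the word \<open>[Vertex u]\<close>.\<close>
  have arrows: "word_act G (map Arrow es) q =
      (if path_target G (u, es) = fst q then Some (u, es @ snd q) else None)"
    if "(u, es) \<in> paths G" "es \<noteq> []" for u es
    using that
  proof (induction es arbitrary: u)
    case (Cons e es)
    then show ?case by (cases "es = []") auto
  qed simp
  show ?thesis
  proof (cases p)
    case (Pair u es)
    with arrows[of u es] assms show ?thesis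
      by (cases "es = []") (auto simp: path_prod_eq)
  qed
qed

end

text \<open>The parameter \<open>scalars\<close> only fixes the type of the ground field.\<close>

locale leavitt = wf_digraph \<Gamma> for \<Gamma> :: "('v, 'e) pre_digraph" +
  fixes scalars :: "'k::field itself"
  assumes row_finite: "row_finite \<Gamma>"
begin

section \<open>The Leavitt ideal and its action on paths\<close>

abbreviation gens where "gens \<equiv> leavitt_gens \<Gamma>"
abbreviation words where "words \<equiv> lists gens - {[]}"
abbreviation concat_prod :: "('v, 'e) leavitt_gen list \<Rightarrow> _" where "concat_prod \<equiv> \<lambda>v w. Some (v @ w)"
abbreviation ideal :: "(('v, 'e) leavitt_gen list \<Rightarrow>\<^sub>0 'k) set" where "ideal \<equiv> leavitt_ideal \<Gamma>"

lemma finite_out_arcs: "v \<in> verts \<Gamma> \<Longrightarrow> finite (out_arcs \<Gamma> v)"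
  using row_finite by (auto simp: row_finite_def)

lemma relators_keys:
  "a \<in> (leavitt_relators \<Gamma> :: (_ \<Rightarrow>\<^sub>0 'k) set) \<Longrightarrow> Poly_Mapping.keys a \<subseteq> words"
  unfolding leavitt_relators_def
  by (elim UnE CollectE exE conjE; hypsubst; intro keys_diff_subset keys_sum_subset)
    (auto simp: leavitt_gens_def)

lemma ideal_keys: "a \<in> ideal \<Longrightarrow> Poly_Mapping.keys a \<subseteq> words"
  unfolding leavitt_ideal_def
proof (induction rule: generated_ideal.induct)
  case (gen a)
  then show ?case by (rule relators_keys)
next
  case (add a b)
  then show ?case by (simp add: free_algebra_def keys_add_subset)
next
  case (smult a c)
  then show ?case using keys_scale[of c a] by (auto simp: free_algebra_def)
next
  case (lmult r a)
  then show ?case by (simp add: free_algebra_def) (rule keys_bilinear_ext[of r words a words], auto)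
next
  case (rmult a r)
  then show ?case by (simp add: free_algebra_def) (rule keys_bilinear_ext[of a words r words], auto)
qed (simp add: free_algebra_def)

sublocale free: basis_ideal words concat_prod ideal
proof
  fix a b :: "('v, 'e) leavitt_gen list \<Rightarrow>\<^sub>0 'k" and c
  show "0 \<in> ideal"
    using generated_ideal.zero[of "free_algebra gens"] by (simp add: leavitt_ideal_def free_algebra_def)
  show "a + b \<in> ideal" if "a \<in> ideal" "b \<in> ideal"
    using generated_ideal.add[of a "free_algebra gens" _ b] that
    by (simp add: leavitt_ideal_def free_algebra_def)
  show "scale c a \<in> ideal" if "a \<in> ideal"
    using generated_ideal.smult[of a "free_algebra gens" _ c] that
    by (simp add: leavitt_ideal_def free_algebra_def)
  show "bilinear_ext concat_prod a b \<in> ideal" if "Poly_Mapping.keys a \<subseteq> words" "b \<in> ideal"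
    using generated_ideal.lmult[of a "free_algebra gens" b] that
    by (simp add: leavitt_ideal_def free_algebra_def)
  show "bilinear_ext concat_prod a b \<in> ideal" if "a \<in> ideal" "Poly_Mapping.keys b \<subseteq> words"
    using generated_ideal.rmult[of a "free_algebra gens" _ b] that
    by (simp add: leavitt_ideal_def free_algebra_def)
qed (auto simp: ideal_keys)

abbreviation act where "act \<equiv> bilinear_ext (word_act \<Gamma>)"

lemma act_act: "act (bilinear_ext concat_prod a b) c = act a (act b c)"
  by (rule bilinear_ext_assoc[OF subset_UNIV subset_UNIV subset_UNIV]) (simp add: word_act_append)

text \<open>Linear combinations of paths are allowed because, for a product with \<open>r\<close> on
  the right, the argument is itself of the form \<open>act r b\<close>.\<close>

definition annihilates :: "nat \<Rightarrow> (('v, 'e) leavitt_gen list \<Rightarrow>\<^sub>0 'k) \<Rightarrow> bool"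
  where "annihilates n a \<longleftrightarrow>
    (\<forall>b. Poly_Mapping.keys b \<subseteq> {q \<in> paths \<Gamma>. deep \<Gamma> n q} \<longrightarrow> act a b = 0)"

lemma annihilatesI:
  assumes "\<And>q c. \<lbrakk>q \<in> paths \<Gamma>; deep \<Gamma> n q\<rbrakk> \<Longrightarrow> act a (Poly_Mapping.single q c) = 0"
  shows "annihilates n a"
  unfolding annihilates_def
proof (intro allI impI)
  fix b :: "'v \<times> 'e list \<Rightarrow>\<^sub>0 'k"
  assume "Poly_Mapping.keys b \<subseteq> {q \<in> paths \<Gamma>. deep \<Gamma> n q}"
  then show "act a b = 0"
    by (induction b rule: poly_mapping_induct_keys) (simp_all add: assms bilinear_ext_add_right)
qed

lemma annihilates_mono: "annihilates m a \<Longrightarrow> m \<le> n \<Longrightarrow> annihilates n a"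
  unfolding annihilates_def using deep_mono by blast

text \<open>The depth 1 is due to the family of sums alone: it rules out the paths of length 0 at
  vertices that emit arrows.\<close>

lemma relators_annihilate:
  assumes "a \<in> leavitt_relators \<Gamma>"
  shows "annihilates 1 a"
proof (rule annihilatesI)
  fix q and c :: 'k
  assume q: "q \<in> paths \<Gamma>" "deep \<Gamma> 1 q"
  obtain u p where up: "q = (u, p)" by (cases q)
  have sum: "act (word [Vertex v] - (\<Sum>e\<in>out_arcs \<Gamma> v. word [Arrow e, Ghost e])) (Poly_Mapping.single q c) = 0"
    if v: "v \<in> verts \<Gamma>" "out_arcs \<Gamma> v \<noteq> {}" for v
  proof (cases p)
    case Nil
    \<comment> \<open>A path of length 0 and depth 1 sits at a sink, while \<open>v\<close> emits an
      arrow.\<close>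
    then have "v \<noteq> u" using q v up by (auto simp: deep_def)
    then show ?thesis using Nil up
      by (simp add: bilinear_ext_diff_left bilinear_ext_sum_left)
  next
    case (Cons f p')
    \<comment> \<open>Only the first arrow \<open>f\<close> of the path survives. It leaves
      \<open>v\<close> exactly when \<open>v\<close> is the source of the path, which is the
      condition for \<open>Vertex v\<close> to act.\<close>
    have "(\<Sum>e\<in>out_arcs \<Gamma> v. opt_single (word_act \<Gamma> [Arrow e, Ghost e] q) c)
        = (\<Sum>e\<in>out_arcs \<Gamma> v. if e = f then Poly_Mapping.single q c else 0)"
      using q Cons up by (intro sum.cong) auto
    also have "\<dots> = (if f \<in> out_arcs \<Gamma> v then Poly_Mapping.single q c else 0)"
      using finite_out_arcs[OF v(1)] by (simp add: sum.delta')
    finally show ?thesis using q Cons up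
      by (auto simp: bilinear_ext_diff_left bilinear_ext_sum_left)
  qed
  show "act a (Poly_Mapping.single q c) = 0"
    using assms q up sum unfolding leavitt_relators_def
    by (elim UnE CollectE exE conjE)
      (auto simp: bilinear_ext_diff_left split: list.splits)
qed

lemma deep_bound:
  assumes "Poly_Mapping.keys (r :: _ \<Rightarrow>\<^sub>0 'k) \<subseteq> words"
  obtains n where "\<And>w. w \<in> Poly_Mapping.keys r \<Longrightarrow> length w \<le> n"
  using finite_nat_set_iff_bounded_le[of "length ` Poly_Mapping.keys r"] by auto

text \<open>Sums take the maximum of two depths, and left factors act after the annihilation and
  change nothing. A right factor acts before it and may shorten the path, so its longest word is
  added to the depth.\<close>

lemma ideal_annihilates:
  assumes "a \<in> ideal"
  obtains n where "annihilates n a"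
proof -
  have "\<exists>n. annihilates n a"
    using assms unfolding leavitt_ideal_def
  proof (induction rule: generated_ideal.induct)
    case (gen a)
    then show ?case using relators_annihilate by blast
  next
    case zero
    then show ?case by (simp add: annihilates_def free_algebra_def)
  next
    case (add a b)
    then obtain m n where "annihilates m a" "annihilates n b" by blast
    then have "annihilates (max m n) a" "annihilates (max m n) b"
      by (auto intro: annihilates_mono)
    then show ?case
      by (auto simp: annihilates_def free_algebra_def bilinear_ext_add_left intro!: exI[of _ "max m n"])
  next
    case (smult a c)
    then obtain n where "annihilates n a" by blast
    then have "annihilates n (scale c a)" by (simp add: annihilates_def bilinear_ext_scale_left)
    then show ?case by (auto simp: free_algebra_def)
  next
    case (lmult r a)
    then obtain n where "annihilates n a" by blast
    then have "annihilates n (bilinear_ext concat_prod r a)" by (simp add: annihilates_def act_act)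
    then show ?case by (auto simp: free_algebra_def)
  next
    case (rmult a r)
    then obtain n where n: "annihilates n a" by blast
    have r: "Poly_Mapping.keys r \<subseteq> words" using rmult by (simp add: free_algebra_def)
    obtain N where N: "length w \<le> N" if "w \<in> Poly_Mapping.keys r" for w
      using deep_bound[OF r] by blast
    have "act (bilinear_ext concat_prod a r) b = 0"
      if b: "Poly_Mapping.keys b \<subseteq> {q \<in> paths \<Gamma>. deep \<Gamma> (N + n) q}" for b
    proof -
      \<comment> \<open>A word of \<open>r\<close> strips at most \<open>N\<close> arrows and keeps
        the end of the path, so depth \<open>N + n\<close> leaves depth \<open>n\<close>.\<close>
      have "Poly_Mapping.keys (act r b) \<subseteq> {q \<in> paths \<Gamma>. deep \<Gamma> n q}"
      proof (rule keys_bilinear_ext[OF order_refl b])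
        fix w q q'
        assume w: "w \<in> Poly_Mapping.keys r" and q: "q \<in> {q \<in> paths \<Gamma>. deep \<Gamma> (N + n) q}"
          and q': "word_act \<Gamma> w q = Some q'"
        have "w \<in> lists gens" using w r by blast
        from word_act_path[OF this _ q'] q N[OF w]
        show "q' \<in> {q \<in> paths \<Gamma>. deep \<Gamma> n q}" by (auto simp: deep_def)
      qed
      then show ?thesis using n by (simp add: act_act annihilates_def)
    qed
    then show ?case by (auto simp: annihilates_def free_algebra_def)
  qed
  then show thesis using that by blast
qed


section \<open>The Leavitt path algebra as a left module\<close>

abbreviation "Q \<equiv> free.Q"
abbreviation cls where "cls a \<equiv> ideal +>\<^bsub>free.B\<^esub> a"
abbreviation wcls where "wcls w \<equiv> cls (word w)"

sublocale Q: nonunital_ring Q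
  by (rule free.nonunital_ring_quotient)

lemma wcls_append:
  "\<lbrakk>v \<in> words; w \<in> words\<rbrakk> \<Longrightarrow> wcls v \<otimes>\<^bsub>Q\<^esub> wcls w = wcls (v @ w)"
  by (subst free.mult_quotient) auto

lemma wcls_closed: "w \<in> words \<Longrightarrow> wcls w \<in> carrier Q"
  by (rule free.coset_closed) auto

lemma mult_cls_zero: "C \<in> carrier Q \<Longrightarrow> C \<otimes>\<^bsub>Q\<^esub> cls 0 = cls 0" "C \<in> carrier Q \<Longrightarrow> cls 0 \<otimes>\<^bsub>Q\<^esub> C = cls 0"
  by (auto simp: free.carrier_quotient free.mult_quotient)

section \<open>The Leavitt relations between classes of words\<close>

lemma cls_relator: "a - b \<in> leavitt_relators \<Gamma> \<Longrightarrow> cls a = cls b"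
  unfolding free.coset_eq_iff by (subst leavitt_ideal_def) (rule generated_ideal.gen)

lemma gen_in_gens [simp]:
  "Vertex v \<in> gens \<longleftrightarrow> v \<in> verts \<Gamma>"
  "Arrow e \<in> gens \<longleftrightarrow> e \<in> arcs \<Gamma>"
  "Ghost e \<in> gens \<longleftrightarrow> e \<in> arcs \<Gamma>"
  by (auto simp: leavitt_gens_def)

lemma gen_target_in_verts: "g \<in> gens \<Longrightarrow> gen_target \<Gamma> g \<in> verts \<Gamma>"
  by (auto simp: leavitt_gens_def)

lemma cls_Vertex_Vertex:
  assumes "v \<in> verts \<Gamma>" "w \<in> verts \<Gamma>"
  shows "wcls [Vertex v] \<otimes>\<^bsub>Q\<^esub> wcls [Vertex w] = (if v = w then wcls [Vertex v] else cls 0)"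
proof -
  have "word [Vertex v, Vertex w] - (if v = w then word [Vertex v] else 0)
      \<in> (leavitt_relators \<Gamma> :: (_ \<Rightarrow>\<^sub>0 'k) set)"
    unfolding leavitt_relators_def using assms by blast
  with cls_relator have "wcls [Vertex v, Vertex w] = cls (if v = w then word [Vertex v] else 0)" by blast
  then show ?thesis
    using assms wcls_append[of "[Vertex v]" "[Vertex w]"] by simp
qed

lemma cls_source:
  assumes "g \<in> gens"
  shows "wcls [Vertex (gen_source \<Gamma> g)] \<otimes>\<^bsub>Q\<^esub> wcls [g] = wcls [g]"
proof (cases "g \<in> range Vertex")
  case True
  then show ?thesis using assms by (auto simp: cls_Vertex_Vertex)
next
  case False
  then have g: "g \<in> Arrow ` arcs \<Gamma> \<union> Ghost ` arcs \<Gamma>"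
    using assms by (auto simp: leavitt_gens_def)
  then have "word [Vertex (gen_source \<Gamma> g), g] - word [g] \<in> (leavitt_relators \<Gamma> :: (_ \<Rightarrow>\<^sub>0 'k) set)"
    unfolding leavitt_relators_def by blast
  with cls_relator have "wcls [Vertex (gen_source \<Gamma> g), g] = wcls [g]" by blast
  moreover have "gen_source \<Gamma> g \<in> verts \<Gamma>" using g by auto
  ultimately show ?thesis
    using assms wcls_append[of "[Vertex (gen_source \<Gamma> g)]" "[g]"] by simp
qed

lemma cls_target:
  assumes "g \<in> gens"
  shows "wcls [g] \<otimes>\<^bsub>Q\<^esub> wcls [Vertex (gen_target \<Gamma> g)] = wcls [g]"
proof (cases "g \<in> range Vertex")
  case True
  then show ?thesis using assms by (auto simp: cls_Vertex_Vertex)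
next
  case False
  then have g: "g \<in> Arrow ` arcs \<Gamma> \<union> Ghost ` arcs \<Gamma>"
    using assms by (auto simp: leavitt_gens_def)
  then have "word [g, Vertex (gen_target \<Gamma> g)] - word [g] \<in> (leavitt_relators \<Gamma> :: (_ \<Rightarrow>\<^sub>0 'k) set)"
    unfolding leavitt_relators_def by blast
  with cls_relator have "wcls [g, Vertex (gen_target \<Gamma> g)] = wcls [g]" by blast
  then show ?thesis
    using assms gen_target_in_verts[OF assms] wcls_append[of "[g]" "[Vertex (gen_target \<Gamma> g)]"] by simp
qed

lemma cls_Ghost_Arrow:
  assumes "e \<in> arcs \<Gamma>" "f \<in> arcs \<Gamma>"
  shows "wcls [Ghost e] \<otimes>\<^bsub>Q\<^esub> wcls [Arrow f] = (if e = f then wcls [Vertex (head \<Gamma> e)] else cls 0)"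
proof -
  have "word [Ghost e, Arrow f] - (if e = f then word [Vertex (head \<Gamma> e)] else 0)
      \<in> (leavitt_relators \<Gamma> :: (_ \<Rightarrow>\<^sub>0 'k) set)"
    unfolding leavitt_relators_def using assms by blast
  with cls_relator have
    "wcls [Ghost e, Arrow f] = cls (if e = f then word [Vertex (head \<Gamma> e)] else 0)" by blast
  then show ?thesis
    using assms wcls_append[of "[Ghost e]" "[Arrow f]"] by simp
qed

lemma cls_Vertex_sum:
  "\<lbrakk>v \<in> verts \<Gamma>; out_arcs \<Gamma> v \<noteq> {}\<rbrakk>
    \<Longrightarrow> wcls [Vertex v] = cls (\<Sum>e\<in>out_arcs \<Gamma> v. word [Arrow e, Ghost e])"
  by (rule cls_relator) (auto simp: leavitt_relators_def)

text \<open>Inserting the target vertex of g between the factors reduces this to the orthogonality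
  of vertices.\<close>

lemma cls_gen_Vertex:
  assumes g: "g \<in> gens" and v: "v \<in> verts \<Gamma>"
  shows "wcls [g] \<otimes>\<^bsub>Q\<^esub> wcls [Vertex v] = (if v = gen_target \<Gamma> g then wcls [g] else cls 0)"
proof -
  have "wcls [g] \<otimes>\<^bsub>Q\<^esub> wcls [Vertex v] =
      wcls [g] \<otimes>\<^bsub>Q\<^esub> (wcls [Vertex (gen_target \<Gamma> g)] \<otimes>\<^bsub>Q\<^esub> wcls [Vertex v])"
    using g v gen_target_in_verts[OF g]
    by (subst Q.mult_assoc[symmetric]) (simp_all add: cls_target wcls_closed)
  then show ?thesis
    using g v gen_target_in_verts[OF g] by (simp add: cls_Vertex_Vertex cls_target mult_cls_zero wcls_closed)
qed

section \<open>Products of words with long paths\<close>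

lemma path_word_in_words: "q \<in> paths \<Gamma> \<Longrightarrow> path_word q \<in> words"
proof (induction "snd q" arbitrary: q)
  case Nil
  then show ?case by (cases q) auto
next
  case (Cons e p)
  then have "(head \<Gamma> e, p) \<in> paths \<Gamma>" "q = (tail \<Gamma> e, e # p)" "e \<in> arcs \<Gamma>"
    by (cases q; auto)+
  with Cons.hyps(1)[of "(head \<Gamma> e, p)"] show ?case by (auto split: if_splits)
qed

text \<open>For \<open>p = []\<close> the second factor is the class of a vertex and not of an empty
  word, and it is absorbed because an arrow times its target is the arrow.\<close>

lemma path_cls_Cons:
  assumes "(u, e # p) \<in> paths \<Gamma>"
  shows "wcls (path_word (u, e # p)) = wcls [Arrow e] \<otimes>\<^bsub>Q\<^esub> wcls (path_word (head \<Gamma> e, p))"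
proof (cases "p = []")
  case True
  then show ?thesis using assms cls_target[of "Arrow e"] by simp
next
  case False
  then show ?thesis
    using assms path_word_in_words[of "(head \<Gamma> e, p)"] by (subst wcls_append) auto
qed

lemma path_cls_closed: "q \<in> paths \<Gamma> \<Longrightarrow> wcls (path_word q) \<in> carrier Q"
  by (intro wcls_closed path_word_in_words)

lemma path_cls_source:
  assumes "q \<in> paths \<Gamma>"
  shows "wcls [Vertex (fst q)] \<otimes>\<^bsub>Q\<^esub> wcls (path_word q) = wcls (path_word q)"
proof (cases "snd q")
  case Nil
  then show ?thesis using assms by (cases q) (simp add: cls_Vertex_Vertex)
next
  case (Cons e p)
  then have q: "q = (tail \<Gamma> e, e # p)" "e \<in> arcs \<Gamma>" "(head \<Gamma> e, p) \<in> paths \<Gamma>"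
    using assms by (cases q; auto)+
  have "wcls [Vertex (tail \<Gamma> e)] \<otimes>\<^bsub>Q\<^esub> (wcls [Arrow e] \<otimes>\<^bsub>Q\<^esub> wcls (path_word (head \<Gamma> e, p)))
      = wcls [Arrow e] \<otimes>\<^bsub>Q\<^esub> wcls (path_word (head \<Gamma> e, p))"
    using q cls_source[of "Arrow e"]
    by (subst Q.mult_assoc[symmetric]) (simp_all add: wcls_closed path_cls_closed del: path_word.simps)
  then show ?thesis
    using path_cls_Cons[of "tail \<Gamma> e" e p] q by simp
qed

abbreviation opt_cls :: "('v \<times> 'e list) option \<Rightarrow> _"
  where "opt_cls z \<equiv> cls (opt_single (map_option path_word z) 1)"

text \<open>The combinatorial action is multiplication in the Leavitt path algebra wherever the
  depth suffices. It cannot hold for all paths: \<open>Ghost e\<close> times the vertex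
  \<open>tail \<Gamma> e\<close> is the ghost itself, whereas \<open>gen_act\<close> is undefined
  there.\<close>

lemma gen_cls_path_cls:
  assumes g: "g \<in> gens" and q: "q \<in> paths \<Gamma>" and d: "deep \<Gamma> 1 q \<or> g \<notin> range Ghost"
  shows "wcls [g] \<otimes>\<^bsub>Q\<^esub> wcls (path_word q) = opt_cls (gen_act \<Gamma> g q)"
proof -
  note closed = wcls_closed path_cls_closed paths_source[OF q] q
  have source: "wcls [g] \<otimes>\<^bsub>Q\<^esub> wcls (path_word q) =
      (wcls [g] \<otimes>\<^bsub>Q\<^esub> wcls [Vertex (fst q)]) \<otimes>\<^bsub>Q\<^esub> wcls (path_word q)"
    using g by (subst Q.mult_assoc) (simp_all add: closed path_cls_source)
  have no_match: "wcls [g] \<otimes>\<^bsub>Q\<^esub> wcls (path_word q) = cls 0" if "fst q \<noteq> gen_target \<Gamma> g"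
    unfolding source using that g by (simp add: cls_gen_Vertex mult_cls_zero closed)
  show ?thesis
  proof (cases g)
    case (Vertex v)
    then show ?thesis using no_match q by (auto simp: path_cls_source)
  next
    case (Arrow e)
    obtain u p where up: "q = (u, p)" by (cases q)
    show ?thesis
    proof (cases "head \<Gamma> e = u")
      case True
      then show ?thesis
        using Arrow up g q path_cls_Cons[of "tail \<Gamma> e" e p] by simp
    next
      case False
      then show ?thesis using Arrow up no_match by auto
    qed
  next
    case (Ghost e)
    obtain u p where up: "q = (u, p)" by (cases q)
    show ?thesis
    proof (cases p)
      case Nil
      \<comment> \<open>The depth makes \<open>u\<close> a sink, so it cannot be the tail of
        \<open>e\<close>. Both sides then vanish.\<close>
      then have "tail \<Gamma> e \<noteq> u"
        using d Ghost g up by (auto simp: deep_def)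
      then show ?thesis using Ghost up Nil no_match by auto
    next
      case (Cons f p')
      have f: "f \<in> arcs \<Gamma>" "u = tail \<Gamma> f" "(head \<Gamma> f, p') \<in> paths \<Gamma>"
        using q up Cons by auto
      have "wcls [g] \<otimes>\<^bsub>Q\<^esub> wcls (path_word q) =
          (wcls [Ghost e] \<otimes>\<^bsub>Q\<^esub> wcls [Arrow f]) \<otimes>\<^bsub>Q\<^esub> wcls (path_word (head \<Gamma> f, p'))"
        using up Cons q Ghost g f path_cls_Cons[of u f p']
        by (subst Q.mult_assoc) (simp_all add: wcls_closed path_cls_closed del: path_word.simps)
      also have "\<dots> = (if e = f then wcls (path_word (head \<Gamma> f, p')) else cls 0)"
        using Ghost g f path_cls_source[OF f(3)]
        by (simp add: cls_Ghost_Arrow mult_cls_zero path_cls_closed del: path_word.simps)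
      finally show ?thesis
        using Ghost up Cons by auto
    qed
  qed
qed

text \<open>The ghost-free alternative is for words of paths, which must multiply correctly even
  with short paths; the depth alternative is for arbitrary words.\<close>

lemma word_cls_path_cls:
  assumes w: "w \<in> words" and q: "q \<in> paths \<Gamma>"
    and d: "deep \<Gamma> (length w) q \<or> set w \<inter> range Ghost = {}"
  shows "wcls w \<otimes>\<^bsub>Q\<^esub> wcls (path_word q) = opt_cls (word_act \<Gamma> w q)"
  using w d
proof (induction w)
  case (Cons g w)
  then have g: "g \<in> gens" by auto
  show ?case
  proof (cases "w = []")
    case True
    then show ?thesis using gen_cls_path_cls[OF g q] Cons.prems by auto
  next
    case False
    then have w: "w \<in> words" "w \<in> lists gens" using Cons.prems by auto
    have "deep \<Gamma> (length w) q \<or> set w \<inter> range Ghost = {}"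
      using Cons.prems by (auto intro: deep_mono)
    with Cons.IH w have IH: "wcls w \<otimes>\<^bsub>Q\<^esub> wcls (path_word q) = opt_cls (word_act \<Gamma> w q)"
      by blast
    have "wcls (g # w) \<otimes>\<^bsub>Q\<^esub> wcls (path_word q) = wcls [g] \<otimes>\<^bsub>Q\<^esub> (wcls w \<otimes>\<^bsub>Q\<^esub> wcls (path_word q))"
      using wcls_append[of "[g]" w] g w q
      by (subst Q.mult_assoc[symmetric]) (simp_all add: wcls_closed path_cls_closed)
    also have "\<dots> = wcls [g] \<otimes>\<^bsub>Q\<^esub> opt_cls (word_act \<Gamma> w q)"
      by (simp add: IH)
    also have "\<dots> = opt_cls (word_act \<Gamma> (g # w) q)"
    proof (cases "word_act \<Gamma> w q")
      case None
      then show ?thesis using g by (simp add: mult_cls_zero wcls_closed)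
    next
      case (Some q')
      note q' = word_act_path[OF w(2) q Some]
      \<comment> \<open>The word \<open>w\<close> uses up at most its own length, so
        \<open>q'\<close> retains an arrow for \<open>g\<close> unless it ends in a sink.\<close>
      have "deep \<Gamma> 1 q' \<or> g \<notin> range Ghost"
        using Cons.prems(2) q' by (auto simp: deep_def)
      then show ?thesis using gen_cls_path_cls[OF g] q' Some by simp
    qed
    finally show ?thesis .
  qed
qed simp

section \<open>The natural homomorphism and the module structure\<close>

lemma natural_hom_eq: "natural_hom \<Gamma> a = cls (linear_ext path_word a)"
  by (simp add: natural_hom_def linear_ext_def free_algebra_def)

lemma keys_linear_ext_path_word:
  "Poly_Mapping.keys a \<subseteq> paths \<Gamma> \<Longrightarrow> Poly_Mapping.keys (linear_ext path_word a) \<subseteq> words"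
  by (rule keys_linear_ext) (auto simp del: path_word.simps dest: path_word_in_words)

text \<open>This has two uses: with \<open>a\<close> free of ghosts it makes the natural
  homomorphism multiplicative, and with a single long path for \<open>b\<close> it shows that x q
  comes from the path algebra.\<close>

lemma cls_natural_hom:
  assumes a: "Poly_Mapping.keys a \<subseteq> V" and b: "Poly_Mapping.keys b \<subseteq> T"
    and VT: "V \<subseteq> words" "T \<subseteq> paths \<Gamma>"
    and d: "\<And>w q. \<lbrakk>w \<in> V; q \<in> T\<rbrakk> \<Longrightarrow> deep \<Gamma> (length w) q \<or> set w \<inter> range Ghost = {}"
  shows "cls a \<otimes>\<^bsub>Q\<^esub> natural_hom \<Gamma> b = natural_hom \<Gamma> (act a b)"
proof -
  have "cls (bilinear_ext concat_prod a (linear_ext path_word b)) = cls (linear_ext path_word (act a b))"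
    using a
  proof (induction a rule: poly_mapping_induct_keys)
    case (single w r)
    then have w: "w \<in> words" using VT by blast
    show ?case
      using b
    proof (induction b rule: poly_mapping_induct_keys)
      case (single q s)
      then have q: "q \<in> paths \<Gamma>" using VT by blast
      have "wcls (w @ path_word q) = opt_cls (word_act \<Gamma> w q)"
        using wcls_append[OF w path_word_in_words[OF q]]
          word_cls_path_cls[OF w q d[OF \<open>w \<in> V\<close> \<open>q \<in> T\<close>]] by simp
      from free.coset_cong_scale[OF this, of "r * s"] show ?case
        by (cases "word_act \<Gamma> w q") (simp_all add: scale_single)
    qed (simp_all add: bilinear_ext_add_right linear_ext_add flip: free.add_quotient)
  qed (simp_all add: bilinear_ext_add_left linear_ext_add flip: free.add_quotient)
  moreover have "Poly_Mapping.keys a \<subseteq> words" "Poly_Mapping.keys b \<subseteq> paths \<Gamma>"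
    using a b VT by auto
  ultimately show ?thesis
    by (simp add: natural_hom_eq free.mult_quotient keys_linear_ext_path_word)
qed

lemma act_linear_ext_path_word:
  assumes "Poly_Mapping.keys a \<subseteq> paths \<Gamma>" "Poly_Mapping.keys b \<subseteq> paths \<Gamma>"
  shows "act (linear_ext path_word a) b = bilinear_ext (path_prod \<Gamma>) a b"
  using assms(1)
proof (induction a rule: poly_mapping_induct_keys)
  case (single p r)
  show ?case
    using assms(2)
    by (induction b rule: poly_mapping_induct_keys)
      (simp_all add: word_act_path_word bilinear_ext_add_right single del: path_word.simps)
qed (simp_all add: bilinear_ext_add_left linear_ext_add)

lemma natural_hom_mult:
  assumes a: "Poly_Mapping.keys a \<subseteq> paths \<Gamma>" and b: "Poly_Mapping.keys b \<subseteq> paths \<Gamma>"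
  shows "natural_hom \<Gamma> (bilinear_ext (path_prod \<Gamma>) a b) = natural_hom \<Gamma> a \<otimes>\<^bsub>Q\<^esub> natural_hom \<Gamma> b"
proof -
  have "cls (linear_ext path_word a) \<otimes>\<^bsub>Q\<^esub> natural_hom \<Gamma> b = natural_hom \<Gamma> (act (linear_ext path_word a) b)"
  proof (rule cls_natural_hom[OF keys_linear_ext[OF a order_refl] b])
    show "path_word ` paths \<Gamma> \<subseteq> words" by (rule image_subsetI) (rule path_word_in_words)
    fix w q assume "w \<in> path_word ` paths \<Gamma>"
    then show "deep \<Gamma> (length w) q \<or> set w \<inter> range Ghost = {}" by (auto split: if_splits)
  qed simp
  then show ?thesis
    using a b by (simp add: natural_hom_eq act_linear_ext_path_word)
qed

lemma natural_hom_closed: "Poly_Mapping.keys a \<subseteq> paths \<Gamma> \<Longrightarrow> natural_hom \<Gamma> a \<in> carrier Q"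
  by (simp add: natural_hom_eq free.coset_closed keys_linear_ext_path_word)

lemma natural_hom_add: "natural_hom \<Gamma> (a + b) = natural_hom \<Gamma> a \<oplus>\<^bsub>Q\<^esub> natural_hom \<Gamma> b"
  by (simp add: natural_hom_eq linear_ext_add free.add_quotient)

abbreviation A :: "('k, 'v \<times> 'e list \<Rightarrow>\<^sub>0 'k) module" where "A \<equiv> path_algebra \<Gamma>"
abbreviation L :: "('v \<times> 'e list \<Rightarrow>\<^sub>0 'k, (('v, 'e) leavitt_gen list \<Rightarrow>\<^sub>0 'k) set) module"
  where "L \<equiv> leavitt_left_module \<Gamma>"

lemma left_module_simps [simp]:
  "carrier L = carrier Q"
  "add L = add Q"
  "\<zero>\<^bsub>L\<^esub> = \<zero>\<^bsub>Q\<^esub>"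
  "a \<odot>\<^bsub>L\<^esub> C = natural_hom \<Gamma> a \<otimes>\<^bsub>Q\<^esub> C"
  by (simp_all add: leavitt_left_module_def leavitt_path_algebra_def free_algebra_def ring.defs module.defs)

lemma path_algebra_simps [simp]:
  "a \<in> carrier A \<longleftrightarrow> Poly_Mapping.keys a \<subseteq> paths \<Gamma>"
  "a \<otimes>\<^bsub>A\<^esub> b = bilinear_ext (path_prod \<Gamma>) a b"
  "a \<oplus>\<^bsub>A\<^esub> b = a + b"
  "\<zero>\<^bsub>A\<^esub> = 0"
  by (simp_all add: path_algebra_def)

lemma left_module_leavitt: "left_module A L"
proof (intro left_module.intro left_module_axioms.intro)
  show "nonunital_ring A"
    unfolding path_algebra_def by (rule basis_ring.nonunital_ring_basis_algebra[OF basis_ring_paths])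
  show "abelian_group L"
  proof (rule abelian_groupI)
    fix C assume "C \<in> carrier L"
    then show "\<exists>D\<in>carrier L. D \<oplus>\<^bsub>L\<^esub> C = \<zero>\<^bsub>L\<^esub>"
      by (intro bexI[of _ "\<ominus>\<^bsub>Q\<^esub> C"]) (simp_all add: Q.l_neg)
  qed (simp_all add: Q.a_ac)
qed (simp_all add: natural_hom_closed natural_hom_add natural_hom_mult Q.mult_closed Q.mult_assoc
    Q.distrib_left Q.distrib_right)

end


section \<open>Flatness\<close>

locale leavitt_tensor = leavitt \<Gamma> scalars +
    Tensor: module_pair "path_algebra \<Gamma> :: ('k, 'v \<times> 'e list \<Rightarrow>\<^sub>0 'k) module" M
      "leavitt_left_module \<Gamma> :: ('v \<times> 'e list \<Rightarrow>\<^sub>0 'k, (('v, 'e) leavitt_gen list \<Rightarrow>\<^sub>0 'k) set) module"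
  for \<Gamma> :: "('v, 'e) pre_digraph" and scalars :: "'k::field itself"
    and M :: "('v \<times> 'e list \<Rightarrow>\<^sub>0 'k, 'm) right_mod"
begin

section \<open>Values of tensors at paths\<close>

abbreviation "pairs \<equiv> carrier M \<times> carrier Q"
abbreviation K where "K \<equiv> Tensor.K"

text \<open>The choice does not involve \<open>M\<close>, so values in different modules are
  computed from the same representatives and can be compared at every path.\<close>

definition rep :: "(('v, 'e) leavitt_gen list \<Rightarrow>\<^sub>0 'k) set \<Rightarrow> ('v, 'e) leavitt_gen list \<Rightarrow>\<^sub>0 'k"
  where "rep C = (SOME a. Poly_Mapping.keys a \<subseteq> words \<and> cls a = C)"

lemma rep:
  assumes "C \<in> carrier Q"
  shows "Poly_Mapping.keys (rep C) \<subseteq> words" "cls (rep C) = C"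
proof -
  have "\<exists>a. Poly_Mapping.keys a \<subseteq> words \<and> cls a = C"
    using assms by (auto simp: free.carrier_quotient)
  from someI_ex[OF this] show "Poly_Mapping.keys (rep C) \<subseteq> words" "cls (rep C) = C"
    by (auto simp: rep_def)
qed

definition germ_gen :: "'v \<times> 'e list \<Rightarrow> 'm \<times> (('v, 'e) leavitt_gen list \<Rightarrow>\<^sub>0 'k) set \<Rightarrow> 'm"
  where "germ_gen q z = fst z \<cdot>\<^bsub>M\<^esub> act (rep (snd z)) (Poly_Mapping.single q 1)"

text \<open>
  The elements of \<open>L \<Gamma>\<close> send long paths into the path algebra, so \<open>m \<otimes> x\<close> has a well-defined
  value \<open>m (x q) \<in> M\<close> at every sufficiently long path \<open>q\<close>.
\<close>

definition germ :: "'v \<times> 'e list \<Rightarrow> ('m \<times> (('v, 'e) leavitt_gen list \<Rightarrow>\<^sub>0 'k) set \<Rightarrow>\<^sub>0 int) \<Rightarrow> 'm"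
  where "germ q = (SOME h. h \<in> hom (free_Abelian_group pairs) (add_monoid M) \<and>
    (\<forall>z\<in>pairs. h (frag_of z) = germ_gen q z))"

lemma keys_act:
  assumes "Poly_Mapping.keys a \<subseteq> words" "q \<in> paths \<Gamma>"
  shows "Poly_Mapping.keys (act a (Poly_Mapping.single q c)) \<subseteq> paths \<Gamma>"
proof (rule keys_bilinear_ext[OF assms(1)])
  show "Poly_Mapping.keys (Poly_Mapping.single q c) \<subseteq> {q}" by simp
  fix w r z
  assume "w \<in> words" "r \<in> {q}" "word_act \<Gamma> w r = Some z"
  then show "z \<in> paths \<Gamma>" using word_act_path[of w q z] assms(2) by auto
qed

lemma keys_act_rep:
  "\<lbrakk>C \<in> carrier Q; q \<in> paths \<Gamma>\<rbrakk>
    \<Longrightarrow> Poly_Mapping.keys (act (rep C) (Poly_Mapping.single q c)) \<subseteq> paths \<Gamma>"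
  by (rule keys_act[OF rep(1)])

lemma germ_gen_closed:
  assumes "z \<in> pairs" "q \<in> paths \<Gamma>"
  shows "germ_gen q z \<in> carrier M"
proof -
  have "Poly_Mapping.keys (act (rep (snd z)) (Poly_Mapping.single q 1)) \<subseteq> paths \<Gamma>"
    using assms by (intro keys_act_rep) auto
  then show ?thesis
    using assms by (auto simp: germ_gen_def simp del: split_paired_All intro!: Tensor.Mod.rsmult_closed)
qed

lemma germ:
  assumes "q \<in> paths \<Gamma>"
  shows "germ q \<in> hom (free_Abelian_group pairs) (add_monoid M)"
    and "z \<in> pairs \<Longrightarrow> germ q (frag_of z) = germ_gen q z"
proof -
  have "germ_gen q ` pairs \<subseteq> carrier (add_monoid M)"
    by (intro image_subsetI) (simp add: germ_gen_closed[OF _ assms])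
  then obtain h where "h \<in> hom (free_Abelian_group pairs) (add_monoid M)"
    "\<And>z. z \<in> pairs \<Longrightarrow> h (frag_of z) = germ_gen q z"
    by (rule comm_group.free_Abelian_group_universal[OF Tensor.Mod.M.a_comm_group]) iprover
  then have "\<exists>h. h \<in> hom (free_Abelian_group pairs) (add_monoid M) \<and>
      (\<forall>z\<in>pairs. h (frag_of z) = germ_gen q z)" by blast
  from someI_ex[OF this] show "germ q \<in> hom (free_Abelian_group pairs) (add_monoid M)"
    and "z \<in> pairs \<Longrightarrow> germ q (frag_of z) = germ_gen q z"
    unfolding germ_def by blast+
qed

lemma germ_closed: "\<lbrakk>q \<in> paths \<Gamma>; Poly_Mapping.keys c \<subseteq> pairs\<rbrakk> \<Longrightarrow> germ q c \<in> carrier M"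
  using germ(1)[of q] by (auto simp: hom_def)

lemma germ_add:
  "\<lbrakk>q \<in> paths \<Gamma>; Poly_Mapping.keys c \<subseteq> pairs; Poly_Mapping.keys d \<subseteq> pairs\<rbrakk>
    \<Longrightarrow> germ q (c + d) = germ q c \<oplus>\<^bsub>M\<^esub> germ q d"
  using germ(1)[of q] by (auto simp: hom_def)

lemma germ_zero: "q \<in> paths \<Gamma> \<Longrightarrow> germ q 0 = \<zero>\<^bsub>M\<^esub>"
  using germ_add[of q 0 0] germ_closed[of q 0] by simp

lemma germ_minus:
  assumes "q \<in> paths \<Gamma>" "Poly_Mapping.keys c \<subseteq> pairs"
  shows "germ q (- c) = \<ominus>\<^bsub>M\<^esub> germ q c"
  using germ_add[of q "- c" c] germ_closed[of q c] germ_closed[of q "- c"] germ_zero assms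
  by (intro Tensor.Mod.M.minus_equality[symmetric]) (simp_all add: keys_minus)

lemma germ_diff:
  "\<lbrakk>q \<in> paths \<Gamma>; Poly_Mapping.keys c \<subseteq> pairs; Poly_Mapping.keys d \<subseteq> pairs\<rbrakk>
    \<Longrightarrow> germ q (c - d) = germ q c \<ominus>\<^bsub>M\<^esub> germ q d"
  using germ_add[of q c "- d"] by (simp add: germ_minus keys_minus Tensor.Mod.M.minus_eq)

lemma germ_frag_of:
  "\<lbrakk>q \<in> paths \<Gamma>; m \<in> carrier M; C \<in> carrier Q\<rbrakk>
    \<Longrightarrow> germ q (frag_of (m, C)) = m \<cdot>\<^bsub>M\<^esub> act (rep C) (Poly_Mapping.single q 1)"
  by (simp add: germ(2) germ_gen_def)

lemma annihilates_single:
  "\<lbrakk>annihilates n a; q \<in> paths \<Gamma>; deep \<Gamma> n q\<rbrakk> \<Longrightarrow> act a (Poly_Mapping.single q c) = 0"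
  unfolding annihilates_def by (rule allE[of _ "Poly_Mapping.single q c"]) auto

text \<open>This repairs the arbitrariness of \<open>rep\<close>, which respects neither sums nor
  products: two representatives of a class differ by an ideal element, and that dies at some
  depth.\<close>

lemma act_eventually_cong:
  assumes "cls a = cls b"
  obtains n where
    "\<And>q. \<lbrakk>q \<in> paths \<Gamma>; deep \<Gamma> n q\<rbrakk> \<Longrightarrow> act a (Poly_Mapping.single q 1) = act b (Poly_Mapping.single q 1)"
proof -
  have "a - b \<in> ideal" using assms by (simp add: free.coset_eq_iff)
  then obtain n where n: "annihilates n (a - b)" by (rule ideal_annihilates)
  have "act a (Poly_Mapping.single q 1) = act b (Poly_Mapping.single q 1)"
    if "q \<in> paths \<Gamma>" "deep \<Gamma> n q" for q
    using annihilates_single[OF n that, of 1] by (simp add: bilinear_ext_diff_left)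
  then show thesis using that by blast
qed

text \<open>Relators additive in \<open>M\<close> vanish at every path, as both sides share one
  representative. Those that change the Leavitt factor vanish only from some depth on, and finite
  combinations take the largest depth.\<close>

lemma germ_tensor_kernel:
  assumes "c \<in> K"
  shows "\<exists>n. \<forall>q\<in>paths \<Gamma>. deep \<Gamma> n q \<longrightarrow> germ q c = \<zero>\<^bsub>M\<^esub>"
  using assms
proof (induction rule: Tensor.tensor_kernel_induct)
  case zero
  then show ?case by (simp add: germ_zero)
next
  case (add_left m m' C)
  have "germ q (frag_of (m \<oplus>\<^bsub>M\<^esub> m', C) - (frag_of (m, C) + frag_of (m', C))) = \<zero>\<^bsub>M\<^esub>"
    if q: "q \<in> paths \<Gamma>" for q
  proof -
    let ?b = "act (rep C) (Poly_Mapping.single q 1)"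
    have b: "Poly_Mapping.keys ?b \<subseteq> paths \<Gamma>" using add_left q by (simp add: keys_act_rep)
    have "germ q (frag_of (m, C) + frag_of (m', C)) = m \<cdot>\<^bsub>M\<^esub> ?b \<oplus>\<^bsub>M\<^esub> m' \<cdot>\<^bsub>M\<^esub> ?b"
      using add_left q by (simp add: germ_add germ_frag_of)
    then have "germ q (frag_of (m \<oplus>\<^bsub>M\<^esub> m', C)) = germ q (frag_of (m, C) + frag_of (m', C))"
      using add_left q b by (simp add: germ_frag_of Tensor.Mod.rsmult_add_left)
    then show ?thesis
      using add_left q
      by (subst germ_diff) (simp_all add: germ_closed keys_add_subset Tensor.Mod.M.minus_eq Tensor.Mod.M.r_neg)
  qed
  then show ?case by blast
next
  case (add_right m C D)
  then have CD: "C \<in> carrier Q" "D \<in> carrier Q" "C \<oplus>\<^bsub>Q\<^esub> D \<in> carrier Q" by simp_all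
  have "cls (rep (C \<oplus>\<^bsub>Q\<^esub> D)) = cls (rep C + rep D)"
    using CD by (simp add: rep flip: free.add_quotient)
  then obtain n where n: "\<And>q. \<lbrakk>q \<in> paths \<Gamma>; deep \<Gamma> n q\<rbrakk> \<Longrightarrow>
      act (rep (C \<oplus>\<^bsub>Q\<^esub> D)) (Poly_Mapping.single q 1) = act (rep C + rep D) (Poly_Mapping.single q 1)"
    by (rule act_eventually_cong) blast
  have "germ q (frag_of (m, C \<oplus>\<^bsub>Q\<^esub> D) - (frag_of (m, C) + frag_of (m, D))) = \<zero>\<^bsub>M\<^esub>"
    if q: "q \<in> paths \<Gamma>" "deep \<Gamma> n q" for q
  proof -
    have "Poly_Mapping.keys (act (rep C) (Poly_Mapping.single q 1)) \<subseteq> paths \<Gamma>"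
      "Poly_Mapping.keys (act (rep D) (Poly_Mapping.single q 1)) \<subseteq> paths \<Gamma>"
      using CD q by (simp_all add: keys_act_rep)
    then have "germ q (frag_of (m, C \<oplus>\<^bsub>Q\<^esub> D)) = germ q (frag_of (m, C) + frag_of (m, D))"
      using add_right CD q n[OF q] Tensor.Mod.rsmult_add_right[of m "act (rep C) (Poly_Mapping.single q 1)"
          "act (rep D) (Poly_Mapping.single q 1)"]
      by (simp add: germ_frag_of germ_add bilinear_ext_add_left)
    then show ?thesis
      using add_right CD q
      by (subst germ_diff) (simp_all add: germ_closed keys_add_subset Tensor.Mod.M.minus_eq Tensor.Mod.M.r_neg)
  qed
  then have "\<exists>n. \<forall>q\<in>paths \<Gamma>. deep \<Gamma> n q \<longrightarrow> germ q (frag_of (m, C \<oplus>\<^bsub>Q\<^esub> D) - (frag_of (m, C) + frag_of (m, D))) = \<zero>\<^bsub>M\<^esub>"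
    by blast
  then show ?case by simp
next
  case (smult m a C)
  then have a: "Poly_Mapping.keys a \<subseteq> paths \<Gamma>" and C: "C \<in> carrier Q" by simp_all
  let ?D = "natural_hom \<Gamma> a \<otimes>\<^bsub>Q\<^esub> C"
  have D: "?D \<in> carrier Q" using a C by (simp add: Q.mult_closed natural_hom_closed)
  \<comment> \<open>The representative of the product need not be a product of representatives, but
    both lie in one class, and the latter acts as \<open>rep C\<close> followed by left
    multiplication by \<open>a\<close>.\<close>
  have "cls (rep ?D) = cls (bilinear_ext concat_prod (linear_ext path_word a) (rep C))"
    using rep[OF D] rep[OF C] keys_linear_ext_path_word[OF a]
    by (simp add: natural_hom_eq flip: free.mult_quotient)
  then obtain n where n: "\<And>q. \<lbrakk>q \<in> paths \<Gamma>; deep \<Gamma> n q\<rbrakk> \<Longrightarrow> act (rep ?D) (Poly_Mapping.single q 1) =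
      act (bilinear_ext concat_prod (linear_ext path_word a) (rep C)) (Poly_Mapping.single q 1)"
    by (rule act_eventually_cong) blast
  have "germ q (frag_of (m \<cdot>\<^bsub>M\<^esub> a, C) - frag_of (m, ?D)) = \<zero>\<^bsub>M\<^esub>"
    if q: "q \<in> paths \<Gamma>" "deep \<Gamma> n q" for q
  proof -
    let ?b = "act (rep C) (Poly_Mapping.single q 1)"
    have b: "Poly_Mapping.keys ?b \<subseteq> paths \<Gamma>" using C q by (simp add: keys_act_rep)
    have ma: "m \<cdot>\<^bsub>M\<^esub> a \<in> carrier M" using smult by (simp add: Tensor.Mod.rsmult_closed)
    have "germ q (frag_of (m \<cdot>\<^bsub>M\<^esub> a, C)) = m \<cdot>\<^bsub>M\<^esub> bilinear_ext (path_prod \<Gamma>) a ?b"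
      using smult(1) a b C q ma Tensor.Mod.rsmult_mult[of m a ?b] by (simp add: germ_frag_of)
    also have "\<dots> = germ q (frag_of (m, ?D))"
      using smult(1) a b D q n[OF q] by (simp add: germ_frag_of act_act act_linear_ext_path_word)
    finally show ?thesis
      using smult(1) ma C D q
      by (subst germ_diff) (simp_all add: germ_closed Tensor.Mod.M.minus_eq Tensor.Mod.M.r_neg)
  qed
  then have "\<exists>n. \<forall>q\<in>paths \<Gamma>. deep \<Gamma> n q \<longrightarrow> germ q (frag_of (m \<cdot>\<^bsub>M\<^esub> a, C) - frag_of (m, ?D)) = \<zero>\<^bsub>M\<^esub>"
    by blast
  then show ?case by simp
next
  case (add c d)
  then obtain m n where "\<forall>q\<in>paths \<Gamma>. deep \<Gamma> m q \<longrightarrow> germ q c = \<zero>\<^bsub>M\<^esub>"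
    "\<forall>q\<in>paths \<Gamma>. deep \<Gamma> n q \<longrightarrow> germ q d = \<zero>\<^bsub>M\<^esub>" by blast
  then have "germ q (c + d) = \<zero>\<^bsub>M\<^esub>" if "q \<in> paths \<Gamma>" "deep \<Gamma> (max m n) q" for q
    using that deep_mono[of \<Gamma> "max m n" q] Tensor.tensor_kernel_keys[OF add(1)] Tensor.tensor_kernel_keys[OF add(2)]
    by (simp add: germ_add)
  then show ?case by blast
next
  case (minus c)
  then obtain n where "\<forall>q\<in>paths \<Gamma>. deep \<Gamma> n q \<longrightarrow> germ q c = \<zero>\<^bsub>M\<^esub>" by blast
  then show ?case
    using Tensor.tensor_kernel_keys[OF minus(1)] by (intro exI[of _ n]) (simp add: germ_minus)
qed

text \<open>Right multiplication by \<open>b\<close> on \<open>M \<otimes> L \<Gamma>\<close>, on representatives.\<close>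

definition rmult where "rmult b = frag_map (apsnd (\<lambda>C. C \<otimes>\<^bsub>Q\<^esub> cls b))"

lemma rmult_simps [simp]:
  "rmult b 0 = 0"
  "rmult b (frag_of (m, C)) = frag_of (m, C \<otimes>\<^bsub>Q\<^esub> cls b)"
  "rmult b (c + d) = rmult b c + rmult b d"
  "rmult b (c - d) = rmult b c - rmult b d"
  "rmult b (- c) = - rmult b c"
  by (simp_all add: rmult_def)

lemma rmult_cong: "cls a = cls b \<Longrightarrow> rmult a = rmult b"
  by (simp add: rmult_def)

text \<open>Right multiplication commutes with the left module structure, so relators go to relators
  of the same kind.\<close>

lemma rmult_tensor_kernel:
  assumes "c \<in> K" and b: "Poly_Mapping.keys b \<subseteq> words"
  shows "rmult b c \<in> K"
  using assms(1)
proof (induction rule: Tensor.tensor_kernel_induct)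
  case (add_left m m' C)
  then show ?case
    using Tensor.tensor_kernel_add_left[of m m' "C \<otimes>\<^bsub>Q\<^esub> cls b"] b
    by (simp add: Q.mult_closed free.coset_closed)
next
  case (add_right m C D)
  then show ?case
    using Tensor.tensor_kernel_add_right[of m "C \<otimes>\<^bsub>Q\<^esub> cls b" "D \<otimes>\<^bsub>Q\<^esub> cls b"] b
    by (simp add: Q.mult_closed Q.distrib_right free.coset_closed)
next
  case (smult m a C)
  then show ?case
    using Tensor.tensor_kernel_smult[of m a "C \<otimes>\<^bsub>Q\<^esub> cls b"] b
    by (simp add: Q.mult_closed Q.mult_assoc natural_hom_closed free.coset_closed)
qed (simp_all add: Tensor.tensor_kernel_0 Tensor.tensor_kernel_add Tensor.tensor_kernel_minus)

lemma rmult_mult: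
  assumes "Poly_Mapping.keys c \<subseteq> pairs" "Poly_Mapping.keys a \<subseteq> words" "Poly_Mapping.keys b \<subseteq> words"
  shows "rmult (bilinear_ext concat_prod a b) c = rmult b (rmult a c)"
  using assms(1)
proof (induction c rule: frag_induction)
  case (one z)
  then show ?case using assms(2,3)
    by (cases z) (simp add: Q.mult_assoc free.coset_closed flip: free.mult_quotient)
qed simp_all

text \<open>Unlike \<open>rmult_mult\<close>, which is an equality of formal sums, additivity in the
  multiplier needs the relators that split the second component.\<close>

lemma rmult_add:
  assumes "Poly_Mapping.keys c \<subseteq> pairs" "Poly_Mapping.keys a \<subseteq> words" "Poly_Mapping.keys b \<subseteq> words"
  shows "rmult (a + b) c - (rmult a c + rmult b c) \<in> K"
  using assms(1)
proof (induction c rule: frag_induction)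
  case (one z)
  obtain m C where z: "z = (m, C)" "m \<in> carrier M" "C \<in> carrier Q" using one by auto
  have "C \<otimes>\<^bsub>Q\<^esub> cls (a + b) = C \<otimes>\<^bsub>Q\<^esub> cls a \<oplus>\<^bsub>Q\<^esub> C \<otimes>\<^bsub>Q\<^esub> cls b"
    using z assms(2,3) by (simp add: Q.distrib_left free.coset_closed flip: free.add_quotient)
  then show ?case
    using Tensor.tensor_kernel_add_right[of m "C \<otimes>\<^bsub>Q\<^esub> cls a" "C \<otimes>\<^bsub>Q\<^esub> cls b"] z assms(2,3)
    by (simp add: Q.mult_closed free.coset_closed)
next
  case (diff c d)
  then show ?case using Tensor.tensor_kernel_diff[OF diff] by (simp add: algebra_simps)
qed (simp add: Tensor.tensor_kernel_0)

lemma rmult_zero: "Poly_Mapping.keys c \<subseteq> pairs \<Longrightarrow> rmult 0 c \<in> K"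
proof (induction c rule: frag_induction)
  case (one z)
  then show ?case
    using Tensor.tensor_kernel_zero_right[of "fst z"]
    by (cases z) (simp add: mult_cls_zero free.zero_quotient)
qed (simp_all add: Tensor.tensor_kernel_0 Tensor.tensor_kernel_diff)

lemma rmult_sum:
  assumes c: "Poly_Mapping.keys c \<subseteq> pairs"
    and f: "\<And>i. i \<in> V \<Longrightarrow> Poly_Mapping.keys (f i) \<subseteq> words" "\<And>i. i \<in> V \<Longrightarrow> rmult (f i) c \<in> K"
  shows "rmult (sum f V) c \<in> K"
  using f
proof (induction V rule: infinite_finite_induct)
  case (insert i V)
  have "rmult (f i + sum f V) c - (rmult (f i) c + rmult (sum f V) c) \<in> K"
    using c insert.prems(1) by (intro rmult_add keys_sum_subset) auto
  moreover have "rmult (f i) c + rmult (sum f V) c \<in> K"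
    using insert by (intro Tensor.tensor_kernel_add) auto
  ultimately show ?case
    using insert.hyps Tensor.tensor_kernel_add by fastforce
qed (use c rmult_zero in auto)

lemma path_cls_target:
  "q \<in> paths \<Gamma> \<Longrightarrow> wcls (path_word q) \<otimes>\<^bsub>Q\<^esub> wcls [Vertex (path_target \<Gamma> q)] = wcls (path_word q)"
proof (induction "snd q" arbitrary: q)
  case Nil
  then show ?case by (cases q) (simp add: cls_Vertex_Vertex)
next
  case (Cons e p)
  then have q: "q = (tail \<Gamma> e, e # p)" "e \<in> arcs \<Gamma>" "(head \<Gamma> e, p) \<in> paths \<Gamma>"
    by (cases q; auto)+
  then have "wcls (path_word (tail \<Gamma> e, e # p)) \<otimes>\<^bsub>Q\<^esub> wcls [Vertex (path_target \<Gamma> (head \<Gamma> e, p))]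
      = wcls [Arrow e] \<otimes>\<^bsub>Q\<^esub> (wcls (path_word (head \<Gamma> e, p)) \<otimes>\<^bsub>Q\<^esub> wcls [Vertex (path_target \<Gamma> (head \<Gamma> e, p))])"
    using paths_target[OF q(3)]
    by (subst path_cls_Cons, simp, subst Q.mult_assoc)
      (simp_all add: wcls_closed path_cls_closed del: path_word.simps)
  also have "\<dots> = wcls (path_word (tail \<Gamma> e, e # p))"
    using Cons.hyps(1)[of "(head \<Gamma> e, p)"] q path_cls_Cons[of "tail \<Gamma> e" e p]
    by (simp del: path_word.simps)
  finally show ?case using q by simp
qed

text \<open>For a long path q with end r, the product C q is the image of some b in the path
  algebra. Writing C q = C q r = b r gives b something to act on, so that it can be moved across the
  tensor sign.\<close>

lemma rmult_path:
  assumes "Poly_Mapping.keys c \<subseteq> pairs"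
  shows "\<exists>n. \<forall>q\<in>paths \<Gamma>. deep \<Gamma> n q \<longrightarrow>
    rmult (word (path_word q)) c - frag_of (germ q c, wcls [Vertex (path_target \<Gamma> q)]) \<in> K"
proof -
  \<comment> \<open>The support is part of the induction statement because germs are additive only
    on formal sums over \<open>pairs\<close>.\<close>
  have "Poly_Mapping.keys c \<subseteq> pairs \<and> (\<exists>n. \<forall>q\<in>paths \<Gamma>. deep \<Gamma> n q \<longrightarrow>
    rmult (word (path_word q)) c - frag_of (germ q c, wcls [Vertex (path_target \<Gamma> q)]) \<in> K)"
    using assms
  proof (induction c rule: frag_induction)
    case zero
    have "frag_of (\<zero>\<^bsub>M\<^esub>, wcls [Vertex (path_target \<Gamma> q)]) \<in> K" if "q \<in> paths \<Gamma>" for q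
      using that paths_target by (intro Tensor.tensor_kernel_zero_left) (simp add: wcls_closed)
    then show ?case
      using Tensor.tensor_kernel_minus by (intro conjI exI[of _ 0] ballI impI) (simp_all add: germ_zero)
  next
    case (one z)
    obtain m C where z: "z = (m, C)" "m \<in> carrier M" "C \<in> carrier Q" using one by auto
    \<comment> \<open>The longest word of the representative: at this depth each of its words
      multiplies with q exactly as it acts.\<close>
    obtain n where n: "\<And>w. w \<in> Poly_Mapping.keys (rep C) \<Longrightarrow> length w \<le> n"
      using deep_bound[OF rep(1)[OF z(3)]] by blast
    have "rmult (word (path_word q)) (frag_of z) -
        frag_of (germ q (frag_of z), wcls [Vertex (path_target \<Gamma> q)]) \<in> K"
      if q: "q \<in> paths \<Gamma>" "deep \<Gamma> n q" for q
    proof -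
      let ?b = "act (rep C) (Poly_Mapping.single q 1)" and ?v = "wcls [Vertex (path_target \<Gamma> q)]"
      have b: "Poly_Mapping.keys ?b \<subseteq> paths \<Gamma>" using z q by (simp add: keys_act_rep)
      have v: "?v \<in> carrier Q" using paths_target[OF q(1)] by (simp add: wcls_closed)
      have "cls (rep C) \<otimes>\<^bsub>Q\<^esub> natural_hom \<Gamma> (Poly_Mapping.single q 1) = natural_hom \<Gamma> ?b"
        using rep(1)[OF z(3)] q n deep_mono[OF q(2)]
        by (intro cls_natural_hom[of _ "Poly_Mapping.keys (rep C)" _ "{q}"]) auto
      then have C: "C \<otimes>\<^bsub>Q\<^esub> wcls (path_word q) = natural_hom \<Gamma> ?b"
        using rep(2)[OF z(3)] by (simp add: natural_hom_eq)
      have "C \<otimes>\<^bsub>Q\<^esub> wcls (path_word q) = C \<otimes>\<^bsub>Q\<^esub> wcls (path_word q) \<otimes>\<^bsub>Q\<^esub> ?v"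
        using z q v by (subst Q.mult_assoc) (simp_all add: path_cls_target path_cls_closed)
      also have "\<dots> = natural_hom \<Gamma> ?b \<otimes>\<^bsub>Q\<^esub> ?v" by (simp add: C)
      finally have "rmult (word (path_word q)) (frag_of z) = frag_of (m, natural_hom \<Gamma> ?b \<otimes>\<^bsub>Q\<^esub> ?v)"
        by (simp add: z)
      moreover have "germ q (frag_of z) = m \<cdot>\<^bsub>M\<^esub> ?b"
        using z q by (simp add: germ_frag_of)
      ultimately show ?thesis
        using Tensor.tensor_kernel_minus[OF Tensor.tensor_kernel_smult[of m ?b ?v]] z b v by simp
    qed
    moreover have "Poly_Mapping.keys (frag_of z) \<subseteq> pairs" using one by simp
    ultimately show ?case by blast
  next
    case (diff c d)
    then obtain n1 n2 where
      n1: "\<And>q. \<lbrakk>q \<in> paths \<Gamma>; deep \<Gamma> n1 q\<rbrakk> \<Longrightarrow>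
        rmult (word (path_word q)) c - frag_of (germ q c, wcls [Vertex (path_target \<Gamma> q)]) \<in> K"
      and n2: "\<And>q. \<lbrakk>q \<in> paths \<Gamma>; deep \<Gamma> n2 q\<rbrakk> \<Longrightarrow>
        rmult (word (path_word q)) d - frag_of (germ q d, wcls [Vertex (path_target \<Gamma> q)]) \<in> K"
      by blast
    have "rmult (word (path_word q)) (c - d) -
        frag_of (germ q (c - d), wcls [Vertex (path_target \<Gamma> q)]) \<in> K"
      if q: "q \<in> paths \<Gamma>" "deep \<Gamma> (max n1 n2) q" for q
    proof -
      let ?v = "wcls [Vertex (path_target \<Gamma> q)]"
      have v: "?v \<in> carrier Q" using paths_target[OF q(1)] by (simp add: wcls_closed)
      have cd: "Poly_Mapping.keys (c - d) \<subseteq> pairs" using diff by (intro keys_diff_subset) simp_all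
      \<comment> \<open>Reading c as (c - d) + d brings in a relator for a sum in
        \<open>M\<close>.\<close>
      have "germ q c = germ q (c - d) \<oplus>\<^bsub>M\<^esub> germ q d"
        using germ_add[OF q(1) cd, of d] diff by simp
      then have k: "frag_of (germ q c, ?v) - (frag_of (germ q (c - d), ?v) + frag_of (germ q d, ?v)) \<in> K"
        using Tensor.tensor_kernel_add_left[of "germ q (c - d)" "germ q d" ?v] diff q v cd
        by (simp add: germ_closed)
      have "deep \<Gamma> n1 q" "deep \<Gamma> n2 q" using deep_mono[OF q(2)] by simp_all
      from Tensor.tensor_kernel_add[OF Tensor.tensor_kernel_diff[OF n1[OF q(1) this(1)] n2[OF q(1) this(2)]] k]
      show ?thesis by (simp add: algebra_simps)
    qed
    moreover have "Poly_Mapping.keys (c - d) \<subseteq> pairs" using diff by (intro keys_diff_subset) simp_all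
    ultimately show ?case by blast
  qed
  then show ?thesis by blast
qed

text \<open>
  A vertex \<open>v\<close> that is not a sink is the sum of the \<open>e e\<^sup>*\<close>, so vanishing of \<open>c q\<close> for
  all deep \<open>q\<close> propagates backwards along paths.
\<close>

lemma rmult_all_paths:
  assumes c: "Poly_Mapping.keys c \<subseteq> pairs"
    and n: "\<And>q. \<lbrakk>q \<in> paths \<Gamma>; deep \<Gamma> n q\<rbrakk> \<Longrightarrow> rmult (word (path_word q)) c \<in> K"
    and q: "q \<in> paths \<Gamma>"
  shows "rmult (word (path_word q)) c \<in> K"
  using q
proof (induction "n - length (snd q)" arbitrary: q rule: less_induct)
  case less
  show ?case
  proof (cases "deep \<Gamma> n q")
    case True
    then show ?thesis using n less.prems by blast
  next
    case False
    let ?v = "path_target \<Gamma> q"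
    obtain u p where up: "q = (u, p)" by (cases q)
    \<comment> \<open>Failing to be deep means two things: the path is short, so the measure drops
      for its extensions, and its end is not a sink, so the end can be expanded.\<close>
    have out: "out_arcs \<Gamma> ?v \<noteq> {}" and len: "length p < n" using False up by (auto simp: deep_def)
    have v: "?v \<in> verts \<Gamma>" using less.prems by (rule paths_target)
    \<comment> \<open>This represents \<open>q e e\<^sup>*\<close>, a right multiple of the longer
      path q e, to which the induction hypothesis applies.\<close>
    let ?f = "\<lambda>e. bilinear_ext concat_prod (word (path_word (u, p @ [e]))) (word [Ghost e])"
    have ext: "(u, p @ [e]) \<in> paths \<Gamma>" if "e \<in> out_arcs \<Gamma> ?v" for e
      using that less.prems up by (auto simp: paths_append)
    have f: "Poly_Mapping.keys (?f e) \<subseteq> words" "rmult (?f e) c \<in> K" if e: "e \<in> out_arcs \<Gamma> ?v" for e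
    proof -
      have w: "path_word (u, p @ [e]) \<in> words" by (rule path_word_in_words[OF ext[OF e]])
      have g: "Ghost e \<in> gens" using e by simp
      show "Poly_Mapping.keys (?f e) \<subseteq> words" using w g by simp
      have "rmult (word (path_word (u, p @ [e]))) c \<in> K"
        using less.hyps[of "(u, p @ [e])"] ext[OF e] len up by simp
      from rmult_tensor_kernel[OF this, of "word [Ghost e]"] show "rmult (?f e) c \<in> K"
        using w g c by (subst rmult_mult) simp_all
    qed
    have "cls (word (path_word q)) = cls (\<Sum>e\<in>out_arcs \<Gamma> ?v. ?f e)"
    proof -
      have "cls (word (path_word q)) = wcls (path_word q) \<otimes>\<^bsub>Q\<^esub> cls (\<Sum>e\<in>out_arcs \<Gamma> ?v. word [Arrow e, Ghost e])"
        using path_cls_target[OF less.prems] cls_Vertex_sum[OF v out] by simp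
      also have "\<dots> = cls (bilinear_ext concat_prod (word (path_word q)) (\<Sum>e\<in>out_arcs \<Gamma> ?v. word [Arrow e, Ghost e]))"
        using path_word_in_words[OF less.prems]
        by (intro free.mult_quotient keys_sum_subset) auto
      also have "\<dots> = cls (\<Sum>e\<in>out_arcs \<Gamma> ?v. word (path_word q @ [Arrow e, Ghost e]))"
        by (simp add: bilinear_ext_sum_right)
      also have "\<dots> = cls (\<Sum>e\<in>out_arcs \<Gamma> ?v. ?f e)"
      proof (cases "p = []")
        case False
        then show ?thesis using up by simp
      next
        case True
        \<comment> \<open>For a path of length 0 the words differ by a leading vertex letter, so the
          two sums agree only as classes, by u e = e.\<close>
        have "cls (\<Sum>e\<in>T. word (path_word q @ [Arrow e, Ghost e])) = cls (\<Sum>e\<in>T. ?f e)"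
          if "finite T" "T \<subseteq> out_arcs \<Gamma> u" for T
          using that
        proof (induction rule: finite_induct)
          case (insert e T)
          then have e: "e \<in> arcs \<Gamma>" "u = tail \<Gamma> e" by auto
          have "wcls [Vertex u, Arrow e, Ghost e] = wcls [Vertex u] \<otimes>\<^bsub>Q\<^esub> (wcls [Arrow e] \<otimes>\<^bsub>Q\<^esub> wcls [Ghost e])"
            using e by (simp add: wcls_append)
          also have "\<dots> = wcls [Arrow e] \<otimes>\<^bsub>Q\<^esub> wcls [Ghost e]"
            using e cls_source[of "Arrow e"] by (subst Q.mult_assoc[symmetric]) (simp_all add: wcls_closed)
          also have "\<dots> = wcls [Arrow e, Ghost e]"
            using e by (simp add: wcls_append)
          finally have "wcls [Vertex u, Arrow e, Ghost e] = wcls [Arrow e, Ghost e]" .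
          then show ?case
            using insert True up by (simp flip: free.add_quotient)
        qed simp
        from this[OF finite_out_arcs order_refl] show ?thesis
          using True up v by simp
      qed
      finally show ?thesis .
    qed
    from rmult_cong[OF this] have "rmult (word (path_word q)) c = rmult (\<Sum>e\<in>out_arcs \<Gamma> ?v. ?f e) c"
      by (rule fun_cong)
    moreover have "rmult (\<Sum>e\<in>out_arcs \<Gamma> ?v. ?f e) c \<in> K" by (rule rmult_sum[OF c f])
    ultimately show ?thesis by (simp only:)
  qed
qed

text \<open>\<open>F\<close> collects the targets of the last letters in a representative of
  \<open>C\<close>. Further vertices multiply these words to 0, so every larger finite set works
  too; this stability lets several classes share one unit.\<close>

lemma local_unit:
  assumes "C \<in> carrier Q"
  obtains F where "finite F" "F \<subseteq> verts \<Gamma>"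
    "\<And>F'. \<lbrakk>finite F'; F \<subseteq> F'; F' \<subseteq> verts \<Gamma>\<rbrakk> \<Longrightarrow> C \<otimes>\<^bsub>Q\<^esub> cls (\<Sum>v\<in>F'. word [Vertex v]) = C"
proof -
  let ?s = "\<lambda>F. (\<Sum>v\<in>F. word [Vertex v]) :: ('v, 'e) leavitt_gen list \<Rightarrow>\<^sub>0 'k"
  have s: "Poly_Mapping.keys (?s F) \<subseteq> words" if "F \<subseteq> verts \<Gamma>" for F
    using that by (intro keys_sum_subset) auto
  have unit: "cls (bilinear_ext concat_prod (Poly_Mapping.single w r) (?s F)) =
      (if gen_target \<Gamma> (last w) \<in> F then cls (Poly_Mapping.single w r) else cls 0)"
    if w: "w \<in> words" and F: "finite F" "F \<subseteq> verts \<Gamma>" for w r F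
    using F
  proof (induction rule: finite_induct)
    case (insert v F)
    have "wcls (w @ [Vertex v]) = (if v = gen_target \<Gamma> (last w) then wcls w else cls 0)"
    proof -
      obtain w' g where wg: "w = w' @ [g]" using w by (cases w rule: rev_cases) auto
      have g: "g \<in> gens" "v \<in> verts \<Gamma>" using w wg insert by auto
      have gv: "wcls [g, Vertex v] = (if v = gen_target \<Gamma> g then wcls [g] else cls 0)"
        using cls_gen_Vertex[OF g] g by (simp add: wcls_append)
      show ?thesis
      proof (cases "w' = []")
        case True
        then show ?thesis using gv wg by simp
      next
        case False
        then have w': "w' \<in> words" using w wg by auto
        have "wcls (w @ [Vertex v]) = wcls w' \<otimes>\<^bsub>Q\<^esub> wcls [g, Vertex v]"
          using w' g wg by (subst wcls_append) auto
        also have "\<dots> = (if v = gen_target \<Gamma> g then wcls w' \<otimes>\<^bsub>Q\<^esub> wcls [g] else cls 0)"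
          using w' gv by (simp add: mult_cls_zero wcls_closed)
        also have "wcls w' \<otimes>\<^bsub>Q\<^esub> wcls [g] = wcls w"
          using w' g wg by (subst wcls_append) auto
        finally show ?thesis using wg by simp
      qed
    qed
    then have "wcls (w @ [Vertex v]) = cls (if v = gen_target \<Gamma> (last w) then word w else 0)" by simp
    from free.coset_cong_scale[OF this, of r]
    have v: "cls (Poly_Mapping.single (w @ [Vertex v]) r) =
        (if v = gen_target \<Gamma> (last w) then cls (Poly_Mapping.single w r) else cls 0)"
      by (simp add: scale_single split: if_splits)
    show ?case
      using insert v
      by (auto simp: bilinear_ext_add_right free.add_quotient[symmetric]) (simp_all add: free.add_quotient)
  qed simp
  obtain a where a: "Poly_Mapping.keys a \<subseteq> words" "C = cls a"
    using assms by (auto simp: free.carrier_quotient)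
  have "\<exists>F. finite F \<and> F \<subseteq> verts \<Gamma> \<and>
      (\<forall>F'. finite F' \<and> F \<subseteq> F' \<and> F' \<subseteq> verts \<Gamma> \<longrightarrow> cls (bilinear_ext concat_prod a (?s F')) = cls a)"
    using a(1)
  proof (induction a rule: poly_mapping_induct_keys)
    case zero
    then show ?case by (intro exI[of _ "{}"]) simp
  next
    case (single w r)
    have "last w \<in> gens" using single by (auto intro: last_in_set)
    then have "gen_target \<Gamma> (last w) \<in> verts \<Gamma>" by (rule gen_target_in_verts)
    then show ?case
      using unit[OF single] by (intro exI[of _ "{gen_target \<Gamma> (last w)}"]) auto
  next
    case (add a b)
    from add.IH(1) obtain F1 where
      F1: "finite F1 \<and> F1 \<subseteq> verts \<Gamma> \<and>
        (\<forall>F'. finite F' \<and> F1 \<subseteq> F' \<and> F' \<subseteq> verts \<Gamma> \<longrightarrow> cls (bilinear_ext concat_prod a (?s F')) = cls a)" ..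
    from add.IH(2) obtain F2 where
      F2: "finite F2 \<and> F2 \<subseteq> verts \<Gamma> \<and>
        (\<forall>F'. finite F' \<and> F2 \<subseteq> F' \<and> F' \<subseteq> verts \<Gamma> \<longrightarrow> cls (bilinear_ext concat_prod b (?s F')) = cls b)" ..
    have "cls (bilinear_ext concat_prod (a + b) (?s F')) = cls (a + b)"
      if F': "finite F'" "F1 \<union> F2 \<subseteq> F'" "F' \<subseteq> verts \<Gamma>" for F'
    proof -
      have "F1 \<subseteq> F'" "F2 \<subseteq> F'" using F' by auto
      then have "cls (bilinear_ext concat_prod a (?s F')) = cls a" "cls (bilinear_ext concat_prod b (?s F')) = cls b"
        by (simp_all only: F1[THEN conjunct2, THEN conjunct2, rule_format] F2[THEN conjunct2, THEN conjunct2, rule_format] F' simp_thms)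
      then show ?thesis
        by (simp only: bilinear_ext_add_left free.add_quotient[symmetric])
    qed
    then show ?case using F1 F2 by (intro exI[of _ "F1 \<union> F2"]) simp
  qed
  then obtain F where F: "finite F \<and> F \<subseteq> verts \<Gamma> \<and>
      (\<forall>F'. finite F' \<and> F \<subseteq> F' \<and> F' \<subseteq> verts \<Gamma> \<longrightarrow> cls (bilinear_ext concat_prod a (?s F')) = cls a)" ..
  show thesis
  proof (rule that)
    show "finite F" "F \<subseteq> verts \<Gamma>" using F by simp_all
    fix F' assume F': "finite F'" "F \<subseteq> F'" "F' \<subseteq> verts \<Gamma>"
    then have "cls (bilinear_ext concat_prod a (?s F')) = cls a" using F by simp
    then show "C \<otimes>\<^bsub>Q\<^esub> cls (?s F') = C"
      using a s[OF F'(3)] by (simp add: free.mult_quotient)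
  qed
qed

text \<open>The formal sum is reproduced exactly and not only modulo \<open>K\<close>, since each
  second component is fixed. The union of the sets from \<open>local_unit\<close> serves all
  components at once.\<close>

lemma rmult_local_unit:
  assumes "Poly_Mapping.keys c \<subseteq> pairs"
  shows "\<exists>F. finite F \<and> F \<subseteq> verts \<Gamma> \<and>
    (\<forall>F'. finite F' \<and> F \<subseteq> F' \<and> F' \<subseteq> verts \<Gamma> \<longrightarrow> rmult (\<Sum>v\<in>F'. word [Vertex v]) c = c)"
  using assms
proof (induction c rule: frag_induction)
  case zero
  then show ?case by (intro exI[of _ "{}"]) simp
next
  case (one z)
  obtain m C where z: "z = (m, C)" "C \<in> carrier Q" using one by auto
  obtain F where "finite F" "F \<subseteq> verts \<Gamma>"
    "\<And>F'. \<lbrakk>finite F'; F \<subseteq> F'; F' \<subseteq> verts \<Gamma>\<rbrakk> \<Longrightarrow> C \<otimes>\<^bsub>Q\<^esub> cls (\<Sum>v\<in>F'. word [Vertex v]) = C"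
    using local_unit[OF z(2)] by blast
  then show ?case using z by auto
next
  case (diff c d)
  then obtain F1 F2 where
    "finite F1 \<and> F1 \<subseteq> verts \<Gamma> \<and>
      (\<forall>F'. finite F' \<and> F1 \<subseteq> F' \<and> F' \<subseteq> verts \<Gamma> \<longrightarrow> rmult (\<Sum>v\<in>F'. word [Vertex v]) c = c)"
    "finite F2 \<and> F2 \<subseteq> verts \<Gamma> \<and>
      (\<forall>F'. finite F' \<and> F2 \<subseteq> F' \<and> F' \<subseteq> verts \<Gamma> \<longrightarrow> rmult (\<Sum>v\<in>F'. word [Vertex v]) d = d)"
    by blast
  then show ?case by (intro exI[of _ "F1 \<union> F2"]) simp
qed

text \<open>The converse of \<open>germ_tensor_kernel\<close>: membership in \<open>K\<close>
  becomes a condition on elements of \<open>M\<close>, which can be pulled back along an injective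
  map.\<close>

lemma tensor_kernel_germI:
  assumes c: "Poly_Mapping.keys c \<subseteq> pairs"
    and germ: "\<And>q. \<lbrakk>q \<in> paths \<Gamma>; deep \<Gamma> n q\<rbrakk> \<Longrightarrow> germ q c = \<zero>\<^bsub>M\<^esub>"
  shows "c \<in> K"
proof -
  obtain N where N: "\<forall>q\<in>paths \<Gamma>. deep \<Gamma> N q \<longrightarrow>
      rmult (word (path_word q)) c - frag_of (germ q c, wcls [Vertex (path_target \<Gamma> q)]) \<in> K"
    using rmult_path[OF c] by blast
  have deep: "rmult (word (path_word q)) c \<in> K" if q: "q \<in> paths \<Gamma>" "deep \<Gamma> (max n N) q" for q
  proof -
    have "deep \<Gamma> n q" "deep \<Gamma> N q" using deep_mono[OF q(2)] by simp_all
    then have "rmult (word (path_word q)) c - frag_of (\<zero>\<^bsub>M\<^esub>, wcls [Vertex (path_target \<Gamma> q)]) \<in> K"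
      using N germ q by metis
    moreover have "frag_of (\<zero>\<^bsub>M\<^esub>, wcls [Vertex (path_target \<Gamma> q)]) \<in> K"
      using paths_target[OF q(1)] by (intro Tensor.tensor_kernel_zero_left) (simp add: wcls_closed)
    ultimately show ?thesis using Tensor.tensor_kernel_add by fastforce
  qed
  have paths: "rmult (word (path_word q)) c \<in> K" if "q \<in> paths \<Gamma>" for q
    using rmult_all_paths[OF c deep that] .
  obtain F where F: "finite F" "F \<subseteq> verts \<Gamma>" "rmult (\<Sum>v\<in>F. word [Vertex v]) c = c"
    using rmult_local_unit[OF c] by blast
  have "rmult (\<Sum>v\<in>F. word [Vertex v]) c \<in> K"
  proof (rule rmult_sum[OF c])
    fix v assume "v \<in> F"
    then have v: "v \<in> verts \<Gamma>" using F by blast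
    then show "Poly_Mapping.keys (word [Vertex v]) \<subseteq> words" by simp
    show "rmult (word [Vertex v]) c \<in> K" using paths[of "(v, [])"] v by simp
  qed
  with F show ?thesis by simp
qed

end

theorem lemma7p3:
  fixes \<Gamma> :: "('v, 'e) pre_digraph"
  assumes "wf_digraph \<Gamma>" and "row_finite \<Gamma>"
  shows "flat_left_module (path_algebra \<Gamma> :: ('k::field, 'v \<times> 'e list \<Rightarrow>\<^sub>0 'k) module)
           (leavitt_left_module \<Gamma>) TYPE('m1) TYPE('m2) TYPE('m3)"
proof (rule flat_left_moduleI)
  interpret wf_digraph \<Gamma> by fact
  interpret leavitt \<Gamma> "TYPE('k)" by unfold_locales fact
  show L: "left_module A L" by (rule left_module_leavitt)
  fix M :: "('v \<times> 'e list \<Rightarrow>\<^sub>0 'k, 'm1) right_mod" and N :: "('v \<times> 'e list \<Rightarrow>\<^sub>0 'k, 'm2) right_mod"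
    and f c
  assume M: "unital_right_module A M" and N: "unital_right_module A N"
    and f: "f \<in> right_module_hom A M N" and inj: "inj_on f (carrier M)"
    and c: "Poly_Mapping.keys c \<subseteq> carrier M \<times> carrier L"
    and K: "frag_map (apfst f) c \<in> tensor_kernel A N L"
  have MP: "module_pair A M L" and NP: "module_pair A N L"
    using M N L by (auto simp: module_pair_def unital_right_module_def)
  interpret TM: leavitt_tensor \<Gamma> "TYPE('k)" M
    by (intro leavitt_tensor.intro leavitt_axioms MP)
  interpret TN: leavitt_tensor \<Gamma> "TYPE('k)" N
    by (intro leavitt_tensor.intro leavitt_axioms NP)
  note fD = right_module_homD[OF f]
  have f0: "f \<zero>\<^bsub>M\<^esub> = \<zero>\<^bsub>N\<^esub>"
    using fD(1)[of "\<zero>\<^bsub>M\<^esub>"] fD(2)[of "\<zero>\<^bsub>M\<^esub>" "\<zero>\<^bsub>M\<^esub>"] by simp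
  \<comment> \<open>Values commute with \<open>f\<close> even at short paths, where they depend on
    representatives, because \<open>TM.rep\<close> and \<open>TN.rep\<close> make the same
    choice.\<close>
  have f_germ: "Poly_Mapping.keys c \<subseteq> TM.pairs \<and> f (TM.germ q c) = TN.germ q (frag_map (apfst f) c)"
    if q: "q \<in> paths \<Gamma>" for q
    using c[simplified]
  proof (induction c rule: frag_induction)
    case zero
    then show ?case using q by (simp add: TM.germ_zero TN.germ_zero f0)
  next
    case (diff c d)
    have keys: "Poly_Mapping.keys (frag_map (apfst f) x) \<subseteq> TN.pairs"
      if "Poly_Mapping.keys x \<subseteq> TM.pairs" for x
      by (rule keys_frag_map[OF that]) (auto simp: fD(1))
    have cd: "Poly_Mapping.keys (c - d) \<subseteq> TM.pairs" using diff by (intro keys_diff_subset) simp_all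
    \<comment> \<open>Differences are handled by cancelling the term of \<open>d\<close> from c = (c
      - d) + d, as \<open>f\<close> is given as a map compatible with addition.\<close>
    have "f (TM.germ q c) = f (TM.germ q (c - d)) \<oplus>\<^bsub>N\<^esub> f (TM.germ q d)"
      using TM.germ_add[OF q cd, of d] diff q cd by (simp add: fD(2) TM.germ_closed)
    moreover have "TN.germ q (frag_map (apfst f) c)
        = TN.germ q (frag_map (apfst f) (c - d)) \<oplus>\<^bsub>N\<^esub> TN.germ q (frag_map (apfst f) d)"
      using TN.germ_add[OF q keys[OF cd] keys[of d]] diff by simp
    ultimately have "f (TM.germ q (c - d)) \<oplus>\<^bsub>N\<^esub> f (TM.germ q d)
        = TN.germ q (frag_map (apfst f) (c - d)) \<oplus>\<^bsub>N\<^esub> f (TM.germ q d)"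
      using diff by simp
    then have "f (TM.germ q (c - d)) = TN.germ q (frag_map (apfst f) (c - d))"
      using TN.Tensor.Mod.M.add.right_cancel[OF fD(1)[OF TM.germ_closed[OF q]] fD(1)[OF TM.germ_closed[OF q cd]]
          TN.germ_closed[OF q keys[OF cd]]] diff by blast
    then show ?case using cd by blast
  next
    case (one z)
    then obtain m C where z: "z = (m, C)" "m \<in> carrier M" "C \<in> carrier Q" by blast
    then have "Poly_Mapping.keys (act (TM.rep C) (Poly_Mapping.single q 1)) \<subseteq> paths \<Gamma>"
      using q by (simp add: TM.keys_act_rep)
    then show ?case
      using z q one fD by (simp add: TM.germ_frag_of TN.germ_frag_of TM.rep_def TN.rep_def)
  qed
  obtain n where n: "\<forall>q\<in>paths \<Gamma>. deep \<Gamma> n q \<longrightarrow> TN.germ q (frag_map (apfst f) c) = \<zero>\<^bsub>N\<^esub>"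
    using TN.germ_tensor_kernel[OF K] by blast
  show "c \<in> tensor_kernel A M L"
  proof (rule TM.tensor_kernel_germI)
    show "Poly_Mapping.keys c \<subseteq> TM.pairs" using c by simp
    fix q assume q: "q \<in> paths \<Gamma>" "deep \<Gamma> n q"
    then have "f (TM.germ q c) = f \<zero>\<^bsub>M\<^esub>" using n f_germ f0 by auto
    moreover have "TM.germ q c \<in> carrier M" using c q by (simp add: TM.germ_closed)
    ultimately show "TM.germ q c = \<zero>\<^bsub>M\<^esub>"
      using inj by (auto dest: inj_onD)
  qed
qed

end
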